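(* Let $(X,T)$ and $(Z,S)$ be minimal systems. Suppose that $\pi:X\to Y$ is a group extension by a compact group $G$. If $Y$ and $Z$ are quasi-disjoint, then $X$ and $Z$ are quasi-disjoint.
   Context: A system $(X,T)$ is a compact metric space $X$ with a homeomorphism $T:X\to X$. It is minimal if every orbit $\{T^nx:n\in\mathbb Z\}$ is dense. A factor map (homomorphism, extension) $\pi:(X,T)\to(Y,S)$ is a continuous surjection with $\pi\circ T=S\circ\pi$. An extension $\pi:X\to Y$ is a group extension by a compact group $G$ if $G$ acts continuously on $X$, the action commutes with $T$, and $Y=X/G$, i.e. $\pi^{-1}(\pi(x))=\{gx:g\in G\}$ for every $x\in X$. A system is equicontinuous if for every $\epsilon>0$ there is $\delta>0$ such that $\rho(x,y)<\delta$ implies $\rho(T^nx,T^ny)<\epsilon$ for all $n\in\mathbb Z$. For a minimal system $(X,T)$, $\pi_X:X\to X_{eq}$ denotes its maximal equicontinuous factor (every factor map from $X$ to an equicontinuous system factors through $\pi_X$). A joining of two systems $(X,T)$ and $(Y,S)$ is a closed $T\times S$-invariant subset of $X\times Y$ with full projections onto $X$ and onto $Y$. Minimal systems $(X,T)$, $(Y,S)$ are quasi-disjoint if $X\times Y$ is the only joining $J$ of $X$ and $Y$ satisfying $(\pi_X\times\pi_Y)(J)=X_{eq}\times Y_{eq}$. *)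

theory Defs
  imports "HOL-Analysis.Analysis" "HOL-Algebra.Group"
begin

section \<open>Topological dynamical systems\<close>

text \<open>
  A system is a compact subset \<open>X\<close> of some metric space together with a map that restricts to a
  self-homeomorphism of \<open>X\<close>; what the map does outside of \<open>X\<close> is irrelevant.
\<close>

definition dynamical_system :: "'a::metric_space set \<Rightarrow> ('a \<Rightarrow> 'a) \<Rightarrow> bool" where
  "dynamical_system X T \<longleftrightarrow> compact X \<and> (\<exists>T'. homeomorphism X X T T')"

definition zpow :: "'a set \<Rightarrow> ('a \<Rightarrow> 'a) \<Rightarrow> int \<Rightarrow> 'a \<Rightarrow> 'a" where
  "zpow X T n = (if 0 \<le> n then T ^^ nat n else inv_into X T ^^ nat (- n))"

definition minimal_system :: "'a::metric_space set \<Rightarrow> ('a \<Rightarrow> 'a) \<Rightarrow> bool" where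
  "minimal_system X T \<longleftrightarrow>
     dynamical_system X T \<and> (\<forall>x\<in>X. X \<subseteq> closure (range (\<lambda>n. zpow X T n x)))"

definition equicontinuous_system :: "'a::metric_space set \<Rightarrow> ('a \<Rightarrow> 'a) \<Rightarrow> bool" where
  "equicontinuous_system X T \<longleftrightarrow>
     dynamical_system X T \<and>
     (\<forall>\<epsilon>>0. \<exists>\<delta>>0. \<forall>x\<in>X. \<forall>y\<in>X. dist x y < \<delta> \<longrightarrow>
        (\<forall>n. dist (zpow X T n x) (zpow X T n y) < \<epsilon>))"

definition factor_map ::
  "'a::metric_space set \<Rightarrow> ('a \<Rightarrow> 'a) \<Rightarrow> 'b::metric_space set \<Rightarrow> ('b \<Rightarrow> 'b) \<Rightarrow> ('a \<Rightarrow> 'b) \<Rightarrow> bool" where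
  "factor_map X T Y S p \<longleftrightarrow>
     continuous_on X p \<and> p ` X = Y \<and> (\<forall>x\<in>X. p (T x) = S (p x))"


section \<open>Group extensions\<close>

definition compact_group :: "('g, 'm) monoid_scheme \<Rightarrow> 'g topology \<Rightarrow> bool" where
  "compact_group G \<tau> \<longleftrightarrow>
     group G \<and> topspace \<tau> = carrier G \<and> compact_space \<tau> \<and> Hausdorff_space \<tau> \<and>
     continuous_map (prod_topology \<tau> \<tau>) \<tau> (\<lambda>(g, h). g \<otimes>\<^bsub>G\<^esub> h) \<and>
     continuous_map \<tau> \<tau> (m_inv G)"

definition continuous_action ::
  "('g, 'm) monoid_scheme \<Rightarrow> 'g topology \<Rightarrow> ('g \<Rightarrow> 'a \<Rightarrow> 'a) \<Rightarrow> 'a::metric_space set \<Rightarrow> bool" where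
  "continuous_action G \<tau> act X \<longleftrightarrow>
     (\<forall>x\<in>X. act \<one>\<^bsub>G\<^esub> x = x) \<and>
     (\<forall>g\<in>carrier G. \<forall>h\<in>carrier G. \<forall>x\<in>X. act (g \<otimes>\<^bsub>G\<^esub> h) x = act g (act h x)) \<and>
     continuous_map (prod_topology \<tau> (top_of_set X)) (top_of_set X) (\<lambda>(g, x). act g x)"

text \<open>The action need not be free.\<close>

definition group_extension ::
  "('g, 'm) monoid_scheme \<Rightarrow> 'g topology \<Rightarrow> ('g \<Rightarrow> 'a \<Rightarrow> 'a) \<Rightarrow>
   'a::metric_space set \<Rightarrow> ('a \<Rightarrow> 'a) \<Rightarrow> 'b::metric_space set \<Rightarrow> ('b \<Rightarrow> 'b) \<Rightarrow> ('a \<Rightarrow> 'b) \<Rightarrow> bool" where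
  "group_extension G \<tau> act X T Y R p \<longleftrightarrow>
     factor_map X T Y R p \<and> continuous_action G \<tau> act X \<and>
     (\<forall>g\<in>carrier G. \<forall>x\<in>X. act g (T x) = T (act g x)) \<and>
     (\<forall>x\<in>X. {x'\<in>X. p x' = p x} = (\<lambda>g. act g x) ` carrier G)"


section \<open>Maximal equicontinuous factors and quasi-disjointness\<close>

text \<open>
  A formula cannot quantify over the types carrying the equicontinuous factors. Every compact
  metric space embeds into the sequence space \<^typ>\<open>nat \<Rightarrow> real\<close> (whose library metric induces the
  product topology), so the universal property is stated for the systems living there; it then
  holds for equicontinuous systems in all metric spaces, see
  \<open>max_equicontinuous_factor_universal\<close> below.
\<close>

definition max_equicontinuous_factor ::
  "'a::metric_space set \<Rightarrow> ('a \<Rightarrow> 'a) \<Rightarrow> 'e::metric_space set \<Rightarrow> ('e \<Rightarrow> 'e) \<Rightarrow> ('a \<Rightarrow> 'e) \<Rightarrow> bool" where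
  "max_equicontinuous_factor X T E R p \<longleftrightarrow>
     equicontinuous_system E R \<and> factor_map X T E R p \<and>
     (\<forall>(F :: (nat \<Rightarrow> real) set) Q q.
        equicontinuous_system F Q \<and> factor_map X T F Q q \<longrightarrow>
        (\<exists>h. factor_map E R F Q h \<and> (\<forall>x\<in>X. q x = h (p x))))"

definition joining ::
  "'a::metric_space set \<Rightarrow> ('a \<Rightarrow> 'a) \<Rightarrow> 'b::metric_space set \<Rightarrow> ('b \<Rightarrow> 'b) \<Rightarrow> ('a \<times> 'b) set \<Rightarrow> bool" where
  "joining X T Y S J \<longleftrightarrow>
     J \<subseteq> X \<times> Y \<and> closed J \<and> map_prod T S ` J = J \<and> fst ` J = X \<and> snd ` J = Y"

text \<open>
  The maximal equicontinuous factor exists (\<open>max_equicontinuous_factor_exists\<close> below) and is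
  unique up to isomorphism, so quantifying over all its realisations is the same as fixing one.
\<close>

definition quasi_disjoint ::
  "'a::metric_space set \<Rightarrow> ('a \<Rightarrow> 'a) \<Rightarrow> 'b::metric_space set \<Rightarrow> ('b \<Rightarrow> 'b) \<Rightarrow> bool" where
  "quasi_disjoint X T Y S \<longleftrightarrow>
     (\<forall>(E :: (nat \<Rightarrow> real) set) R p (F :: (nat \<Rightarrow> real) set) Q q.
        max_equicontinuous_factor X T E R p \<and> max_equicontinuous_factor Y S F Q q \<longrightarrow>
        (\<forall>J. joining X T Y S J \<and> map_prod p q ` J = E \<times> F \<longrightarrow> J = X \<times> Y))"


section \<open>Existence and universality of maximal equicontinuous factors\<close>

lemma dynamical_systemI:
  assumes "compact X" "continuous_on X T" "bij_betw T X X"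
  shows "dynamical_system X T"
  using assms homeomorphism_compact[of X T X]
  by (auto simp: dynamical_system_def bij_betw_def)

lemma dynamical_systemD:
  assumes "dynamical_system X T"
  shows "compact X" "continuous_on X T" "bij_betw T X X"
proof -
  obtain T' where "compact X" and h: "homeomorphism X X T T'"
    using assms by (auto simp: dynamical_system_def)
  then show "compact X" "continuous_on X T" by (auto simp: homeomorphism_def)
  have "inj_on T X" using h by (metis homeomorphism_apply1 inj_onI)
  then show "bij_betw T X X" using h by (auto simp: bij_betw_def homeomorphism_def)
qed

lemma zpow_closed:
  assumes "dynamical_system X T" "x \<in> X"
  shows "zpow X T n x \<in> X"
proof -
  have b: "bij_betw T X X" using dynamical_systemD[OF assms(1)] by simp
  have "(T ^^ k) x \<in> X" for k
    by (induction k) (use b assms(2) in \<open>auto simp: bij_betw_def\<close>)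
  moreover have "(inv_into X T ^^ k) x \<in> X" for k
    by (induction k) (use b assms(2) in \<open>auto simp: bij_betw_def inv_into_into\<close>)
  ultimately show ?thesis by (simp add: zpow_def)
qed

lemma factor_map_zpow:
  assumes X: "dynamical_system X T" and Y: "dynamical_system Y S"
    and p: "factor_map X T Y S p" and x: "x \<in> X"
  shows "p (zpow X T n x) = zpow Y S n (p x)"
proof -
  have bX: "bij_betw T X X" and bY: "bij_betw S Y Y"
    using dynamical_systemD X Y by blast+
  have pT: "p (T x) = S (p x)" and pX: "p x \<in> Y" if "x \<in> X" for x
    using p that by (auto simp: factor_map_def)
  have fwd: "(T ^^ k) x \<in> X \<and> p ((T ^^ k) x) = (S ^^ k) (p x)" for k
    by (induction k) (use bX x pT in \<open>auto simp: bij_betw_def\<close>)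
  have step: "inv_into X T z \<in> X \<and> p (inv_into X T z) = inv_into Y S (p z)" if "z \<in> X" for z
  proof -
    have 1: "inv_into X T z \<in> X" "T (inv_into X T z) = z"
      using bX that by (auto simp: bij_betw_def inv_into_into f_inv_into_f)
    then have "S (p (inv_into X T z)) = p z" using pT by metis
    then show ?thesis using bY 1 pX by (metis bij_betw_inv_into_left)
  qed
  have bwd: "(inv_into X T ^^ k) x \<in> X \<and> p ((inv_into X T ^^ k) x) = (inv_into Y S ^^ k) (p x)" for k
    by (induction k) (use x step in auto)
  show ?thesis using fwd bwd by (simp add: zpow_def)
qed

lemma quotient_system:
  fixes P :: "'a::metric_space \<Rightarrow> 'b::metric_space"
  assumes X: "dynamical_system X T" and P: "continuous_on X P"
    and eq: "\<And>x y. x \<in> X \<Longrightarrow> y \<in> X \<Longrightarrow> P (T x) = P (T y) \<longleftrightarrow> P x = P y"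
  obtains R where "dynamical_system (P ` X) R" "factor_map X T (P ` X) R P"
proof
  define R where "R = P \<circ> T \<circ> inv_into X P"
  note X' = dynamical_systemD[OF X]
  have RP: "R (P x) = P (T x)" if "x \<in> X" for x
  proof -
    have "inv_into X P (P x) \<in> X" "P (inv_into X P (P x)) = P x"
      using that by (auto simp: inv_into_into f_inv_into_f)
    then show ?thesis using eq that by (auto simp: R_def)
  qed
  show "factor_map X T (P ` X) R P"
    using RP P by (auto simp: factor_map_def)
  have TX: "T ` X = X" using X' by (simp add: bij_betw_def)
  have q: "quotient_map (top_of_set X) (top_of_set (P ` X)) P"
    using P X' by (intro T1_Spaces.continuous_imp_quotient_map)
      (auto simp: compact_space_subtopology Hausdorff_space_subtopology)
  have "continuous_on X (P \<circ> T)"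
    using P X' TX by (intro continuous_on_compose) auto
  then have "continuous_on X (R \<circ> P)"
    by (rule continuous_on_eq) (simp add: RP)
  then have c: "continuous_on (P ` X) R"
    using continuous_compose_quotient_map[OF q, of euclidean R] by simp
  have "R ` P ` X = P ` T ` X" using RP by (force simp: image_image)
  moreover have "inj_on R (P ` X)"
    by (auto simp: inj_on_def RP eq)
  ultimately have "bij_betw R (P ` X) (P ` X)" by (simp add: bij_betw_def TX)
  then show "dynamical_system (P ` X) R"
    using c P X' by (intro dynamical_systemI compact_continuous_image)
qed

lemma equicontinuous_if_separated:
  fixes E :: "'e::metric_space set"
  assumes E: "dynamical_system E R"
    and sep: "\<And>a b. a \<in> E \<Longrightarrow> b \<in> E \<Longrightarrow> a \<noteq> b \<Longrightarrow>
      \<exists>(F :: 'f::metric_space set) Q r. equicontinuous_system F Q \<and> factor_map E R F Q r \<and> r a \<noteq> r b"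
  shows "equicontinuous_system E R"
proof (rule ccontr)
  assume "\<not> ?thesis"
  then obtain \<epsilon> where e: "\<epsilon> > 0" and bad: "\<And>\<delta>. \<delta> > 0 \<Longrightarrow> \<exists>x\<in>E. \<exists>y\<in>E. dist x y < \<delta> \<and>
        (\<exists>n. dist (zpow E R n x) (zpow E R n y) \<ge> \<epsilon>)"
    using E by (force simp: equicontinuous_system_def not_less)
  define B where "B i z \<longleftrightarrow> fst z \<in> E \<and> fst (snd z) \<in> E \<and>
      dist (fst z) (fst (snd z)) < 1 / real (Suc i) \<and>
      dist (zpow E R (snd (snd z)) (fst z)) (zpow E R (snd (snd z)) (fst (snd z))) \<ge> \<epsilon>"
    for i :: nat and z :: "'e \<times> 'e \<times> int"
  have "\<exists>z. B i z" for i
  proof -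
    obtain x y n where "x \<in> E" "y \<in> E" "dist x y < 1 / real (Suc i)"
        "dist (zpow E R n x) (zpow E R n y) \<ge> \<epsilon>"
      using bad[of "1 / real (Suc i)"] by auto
    then have "B i (x, y, n)" by (simp add: B_def)
    then show ?thesis by blast
  qed
  then obtain z where z: "\<And>i. B i (z i)" by metis
  define x y n where "x i = fst (z i)" and "y i = fst (snd (z i))" and "n i = snd (snd (z i))" for i
  have xy: "\<And>i. x i \<in> E" "\<And>i. y i \<in> E"
      "\<And>i. dist (x i) (y i) < 1 / real (Suc i)"
      "\<And>i. dist (zpow E R (n i) (x i)) (zpow E R (n i) (y i)) \<ge> \<epsilon>"
    using z by (auto simp: B_def x_def y_def n_def)
  define u v where "u i = zpow E R (n i) (x i)" and "v i = zpow E R (n i) (y i)" for i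
  have uv: "u i \<in> E" "v i \<in> E" for i
    using zpow_closed[OF E] xy by (auto simp: u_def v_def)
  have cE: "compact E" using dynamical_systemD E by blast
  then have "seq_compact (E \<times> E)" by (simp add: compact_Times compact_imp_seq_compact)
  then obtain l s where l: "l \<in> E \<times> E" and s: "strict_mono (s :: nat \<Rightarrow> nat)"
      and lim: "((\<lambda>i. (u i, v i)) \<circ> s) \<longlonglongrightarrow> l"
    using uv unfolding seq_compact_def by (elim allE[of _ "\<lambda>i. (u i, v i)"]) auto
  obtain a b where ab: "l = (a, b)" by force
  have ua: "(\<lambda>i. u (s i)) \<longlonglongrightarrow> a" and vb: "(\<lambda>i. v (s i)) \<longlonglongrightarrow> b"
    using tendsto_fst[OF lim] tendsto_snd[OF lim] by (auto simp: ab o_def)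
  have "a \<in> E" "b \<in> E" using l ab by auto
  have "dist a b \<ge> \<epsilon>"
    by (rule LIMSEQ_le_const[OF tendsto_dist[OF ua vb]]) (use xy in \<open>auto simp: u_def v_def\<close>)
  then have "a \<noteq> b" using e by auto
  then obtain F :: "'f set" and Q r where F: "equicontinuous_system F Q"
      and r: "factor_map E R F Q r" and rab: "r a \<noteq> r b"
    using sep \<open>a \<in> E\<close> \<open>b \<in> E\<close> by metis
  have dF: "dynamical_system F Q" using F by (simp add: equicontinuous_system_def)
  have cr: "continuous_on E r" and rE: "r ` E = F" using r by (auto simp: factor_map_def)
  have "(\<lambda>i. r (u (s i))) \<longlonglongrightarrow> r a" "(\<lambda>i. r (v (s i))) \<longlonglongrightarrow> r b"
    using continuous_on_tendsto_compose[OF cr ua] continuous_on_tendsto_compose[OF cr vb]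
      \<open>a \<in> E\<close> \<open>b \<in> E\<close> uv by auto
  note rlim = tendsto_dist[OF this]
  have uc: "uniformly_continuous_on E r" using cr cE by (rule compact_uniformly_continuous)
  have "dist (r a) (r b) \<le> \<eta>" if "\<eta> > 0" for \<eta>
  proof -
    obtain d where d: "d > 0" "\<And>x y n. x \<in> F \<Longrightarrow> y \<in> F \<Longrightarrow> dist x y < d \<Longrightarrow>
        dist (zpow F Q n x) (zpow F Q n y) < \<eta>"
      using F \<open>\<eta> > 0\<close> unfolding equicontinuous_system_def by metis
    obtain d' where d': "d' > 0" "\<And>x y. x \<in> E \<Longrightarrow> y \<in> E \<Longrightarrow> dist x y < d' \<Longrightarrow> dist (r x) (r y) < d"
      using uc d(1) unfolding uniformly_continuous_on_def by metis
    obtain N where N: "1 / real (Suc N) < d'" using d'(1) nat_approx_posE by blast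
    have "dist (r (u (s i))) (r (v (s i))) \<le> \<eta>" if "i \<ge> N" for i
    proof -
      have "N \<le> s i" using s that seq_suble le_trans by blast
      then have "1 / real (Suc (s i)) \<le> 1 / real (Suc N)" by (simp add: frac_le)
      then have "dist (x (s i)) (y (s i)) < d'" using xy(3)[of "s i"] N by linarith
      then have "dist (r (x (s i))) (r (y (s i))) < d" using d' xy by blast
      then have "dist (zpow F Q (n (s i)) (r (x (s i)))) (zpow F Q (n (s i)) (r (y (s i)))) < \<eta>"
        using d(2) xy rE by blast
      then show ?thesis
        using factor_map_zpow[OF E dF r] xy by (simp add: u_def v_def)
    qed
    then show ?thesis by (intro LIMSEQ_le_const2[OF rlim]) blast
  qed
  then have "dist (r a) (r b) \<le> 0" by (meson dense_ge)
  then show False using rab by simp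
qed

lemma compact_embedding:
  fixes X :: "'a::metric_space set"
  assumes "compact X"
  obtains e :: "'a \<Rightarrow> nat \<Rightarrow> real" where "continuous_on X e" "inj_on e X"
proof (cases "X = {}")
  case True
  show thesis by (rule that[of "\<lambda>_ _. 0"]) (simp_all add: True)
next
  case False
  have tb: "\<forall>\<epsilon>>0. \<exists>k. finite k \<and> X \<subseteq> (\<Union>x\<in>k. ball x \<epsilon>)"
    using assms unfolding compact_eq_totally_bounded by (rule conjunct2)
  have "\<forall>i. \<exists>k. finite k \<and> X \<subseteq> (\<Union>x\<in>k. ball x (1 / real (Suc i)))"
    by (intro allI tb[rule_format]) simp
  from choice[OF this] obtain k where
    k': "\<forall>i. finite (k i) \<and> X \<subseteq> (\<Union>x\<in>k i. ball x (1 / real (Suc i)))" ..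
  have k: "finite (k i)" "X \<subseteq> (\<Union>x\<in>k i. ball x (1 / real (Suc i)))" for i
    using k'[rule_format, of i] by (rule conjunct1, rule conjunct2)
  define D where "D = (\<Union>i. k i)"
  have "countable D" unfolding D_def using k(1) by (auto intro: countable_finite)
  moreover have "k 0 \<noteq> {}" using False k(2)[of 0] by auto
  then have "D \<noteq> {}" unfolding D_def by blast
  ultimately have D: "range (from_nat_into D) = D" by (simp add: range_from_nat_into)
  define e where "e x j = dist x (from_nat_into D j)" for x j
  show thesis
  proof (rule that)
    show "continuous_on X e"
      by (rule continuous_on_coordinatewise_then_product)
        (simp add: e_def continuous_on_dist continuous_on_id)
    show "inj_on e X"
    proof (rule inj_onI, rule ccontr)
      fix x y assume xy: "x \<in> X" "y \<in> X" "e x = e y" "x \<noteq> y"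
      have eq: "dist x d = dist y d" if d: "d \<in> D" for d
      proof -
        obtain j where "d = from_nat_into D j" using d D by blast
        then show ?thesis using fun_cong[OF xy(3), of j] by (simp add: e_def)
      qed
      obtain i where i: "1 / real (Suc i) < dist x y / 2"
        by (rule nat_approx_posE[of "dist x y / 2"]) (use xy(4) in auto)
      obtain d where "d \<in> D" "dist d x < 1 / real (Suc i)"
      proof -
        have "x \<in> (\<Union>d\<in>k i. ball d (1 / real (Suc i)))" using k(2)[of i] xy(1) by (rule subsetD)
        then obtain d where "d \<in> k i" "x \<in> ball d (1 / real (Suc i))" by (rule UN_E)
        then show thesis using that[of d] unfolding D_def by auto
      qed
      moreover have "dist x y \<le> dist d x + dist y d"
        using dist_triangle[of x y d] by (simp add: dist_commute)
      ultimately show False using i eq[of d] by (simp add: dist_commute)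
    qed
  qed
qed

lemma embed_equicontinuous:
  fixes F :: "'c::metric_space set"
  assumes F: "equicontinuous_system F Q"
  obtains F' :: "(nat \<Rightarrow> real) set" and Q' e e' where "equicontinuous_system F' Q'"
    "factor_map F Q F' Q' e" "factor_map F' Q' F Q e'" "\<And>x. x \<in> F \<Longrightarrow> e' (e x) = x"
proof -
  have dF: "dynamical_system F Q" using F by (simp add: equicontinuous_system_def)
  note F' = dynamical_systemD[OF dF]
  obtain e :: "'c \<Rightarrow> nat \<Rightarrow> real" where e: "continuous_on F e" "inj_on e F"
    by (rule compact_embedding[OF F'(1)]) (rule that)
  have QF: "Q x \<in> F" if "x \<in> F" for x using F' that by (auto simp: bij_betw_def)
  have eq: "e (Q x) = e (Q y) \<longleftrightarrow> e x = e y" if "x \<in> F" "y \<in> F" for x y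
    using that e(2) QF bij_betw_imp_inj_on[OF F'(3)] by (simp add: inj_on_eq_iff)
  obtain Q' where Q': "dynamical_system (e ` F) Q'" "factor_map F Q (e ` F) Q' e"
    by (rule quotient_system[OF dF e(1) eq])
  obtain e' where h: "homeomorphism F (e ` F) e e'"
    using homeomorphism_compact[OF F'(1) e(1) refl e(2)] by blast
  then have e': "\<And>x. x \<in> F \<Longrightarrow> e' (e x) = x" by (auto simp: homeomorphism_def)
  have fe': "factor_map (e ` F) Q' F Q e'"
    unfolding factor_map_def
  proof (intro conjI ballI)
    show "continuous_on (e ` F) e'" "e' ` e ` F = F" using h by (auto simp: homeomorphism_def)
    fix z assume "z \<in> e ` F"
    then obtain x where x: "x \<in> F" "z = e x" by auto
    then have "Q' z = e (Q x)" using Q'(2) by (simp add: factor_map_def)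
    then show "e' (Q' z) = Q (e' z)" using x e' QF by simp
  qed
  have sep: "\<exists>(H :: 'c set) U r. equicontinuous_system H U \<and> factor_map (e ` F) Q' H U r \<and> r a \<noteq> r b"
    if "a \<in> e ` F" "b \<in> e ` F" "a \<noteq> b" for a b
  proof -
    have "e' a \<noteq> e' b" using that e' by auto
    with F fe' show ?thesis by (intro exI conjI)
  qed
  have "equicontinuous_system (e ` F) Q'"
    by (rule equicontinuous_if_separated[OF Q'(1) sep])
  then show thesis by (rule that[OF _ Q'(2) fe' e'])
qed

lemma factor_map_comp:
  assumes "factor_map X T Y S p" "factor_map Y S Z R q"
  shows "factor_map X T Z R (q \<circ> p)"
  unfolding factor_map_def
proof (intro conjI ballI)
  show "continuous_on X (q \<circ> p)"
    using assms by (intro continuous_on_compose) (simp_all add: factor_map_def)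
  show "(q \<circ> p) ` X = Z"
    using assms by (simp only: factor_map_def image_comp[symmetric])
  fix x assume "x \<in> X"
  moreover from this have "p x \<in> Y" using assms(1) by (auto simp: factor_map_def)
  ultimately show "(q \<circ> p) (T x) = R ((q \<circ> p) x)" using assms by (simp add: factor_map_def)
qed

theorem max_equicontinuous_factor_universal:
  fixes F :: "'c::metric_space set"
  assumes "max_equicontinuous_factor X T E R p"
    and F: "equicontinuous_system F Q" and q: "factor_map X T F Q q"
  shows "\<exists>h. factor_map E R F Q h \<and> (\<forall>x\<in>X. q x = h (p x))"
proof -
  obtain F' :: "(nat \<Rightarrow> real) set" and Q' e e' where e: "equicontinuous_system F' Q'"
    "factor_map F Q F' Q' e" "factor_map F' Q' F Q e'" "\<And>x. x \<in> F \<Longrightarrow> e' (e x) = x"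
    by (rule embed_equicontinuous[OF F]) (rule that)
  have "\<exists>h. factor_map E R F' Q' h \<and> (\<forall>x\<in>X. (e \<circ> q) x = h (p x))"
    using assms(1) conjI[OF e(1) factor_map_comp[OF q e(2)]]
    unfolding max_equicontinuous_factor_def by blast
  then obtain h where h: "factor_map E R F' Q' h" "\<And>x. x \<in> X \<Longrightarrow> (e \<circ> q) x = h (p x)"
    by blast
  have "q x \<in> F" if "x \<in> X" for x using q that by (auto simp: factor_map_def)
  then have "\<forall>x\<in>X. q x = (e' \<circ> h) (p x)"
    using h(2)[symmetric] e(4) by simp
  with factor_map_comp[OF h(1) e(3)] show ?thesis by (intro exI conjI)
qed

theorem max_equicontinuous_factor_exists:
  fixes X :: "'a::metric_space set"
  assumes X: "dynamical_system X T"
  shows "\<exists>(E :: (nat \<Rightarrow> real) set) R p. max_equicontinuous_factor X T E R p"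
proof -
  note X' = dynamical_systemD[OF X]
  have TX: "T x \<in> X" if "x \<in> X" for x using X' that by (auto simp: bij_betw_def)
  define \<Phi> where "\<Phi> = {q :: 'a \<Rightarrow> nat \<Rightarrow> real. \<exists>F Q. equicontinuous_system F Q \<and> factor_map X T F Q q}"
  define K where "K = {z \<in> X \<times> X. \<forall>q\<in>\<Phi>. q (fst z) = q (snd z)}"
  have cont: "continuous_on X q" if "q \<in> \<Phi>" for q using that by (auto simp: \<Phi>_def factor_map_def)
  have const: "(\<lambda>_ _. 0) \<in> \<Phi>"
  proof -
    define c :: "nat \<Rightarrow> real" where "c = (\<lambda>_. 0)"
    have "equicontinuous_system ((\<lambda>_. c) ` X) id"
    proof -
      have d: "dynamical_system ((\<lambda>_. c) ` X) id"
        using X'(1) by (intro dynamical_systemI compact_continuous_image continuous_intros) auto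
      show ?thesis unfolding equicontinuous_system_def
      proof (intro conjI d allI impI exI[of _ 1] ballI)
        fix \<epsilon> :: real and x y n assume "\<epsilon> > 0" "x \<in> (\<lambda>_. c) ` X" "y \<in> (\<lambda>_. c) ` X"
        then show "dist (zpow ((\<lambda>_. c) ` X) id n x) (zpow ((\<lambda>_. c) ` X) id n y) < \<epsilon>" by auto
      qed simp
    qed
    moreover have "factor_map X T ((\<lambda>_. c) ` X) id (\<lambda>_. c)" by (auto simp: factor_map_def)
    ultimately show ?thesis unfolding \<Phi>_def c_def by blast
  qed
  have "\<forall>i. \<exists>A. finite A \<and> A \<subseteq> \<Phi> \<and>
      (\<forall>z\<in>X \<times> X. infdist z K \<ge> 1 / real (Suc i) \<longrightarrow> (\<exists>q\<in>A. q (fst z) \<noteq> q (snd z)))"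
  proof
    fix i :: nat
    define C where "C = {z \<in> X \<times> X. infdist z K \<ge> 1 / real (Suc i)}"
    have "C = (X \<times> X) \<inter> {z. infdist z K \<ge> 1 / real (Suc i)}" by (auto simp: C_def)
    then have cC: "compact C"
      using X'(1) by (auto intro!: compact_Int_closed compact_Times closed_Collect_le continuous_intros)
    have "\<forall>q\<in>\<Phi>. \<exists>U. open U \<and> U \<inter> (X \<times> X) = {z \<in> X \<times> X. q (fst z) \<noteq> q (snd z)}"
    proof
      fix q assume that: "q \<in> \<Phi>"
      have f: "continuous_on (X \<times> X) (\<lambda>z. q (fst z))"
        by (rule continuous_on_compose2[OF cont[OF that]]) (auto intro: continuous_intros)
      have s: "continuous_on (X \<times> X) (\<lambda>z. q (snd z))"
        by (rule continuous_on_compose2[OF cont[OF that]]) (auto intro: continuous_intros)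
      have "continuous_on (X \<times> X) (\<lambda>z. dist (q (fst z)) (q (snd z)))"
        using f s by (rule continuous_on_dist)
      then obtain U where "open U" "U \<inter> (X \<times> X) = (\<lambda>z. dist (q (fst z)) (q (snd z))) -` {0<..} \<inter> (X \<times> X)"
        unfolding continuous_on_open_invariant using open_greaterThan by meson
      then show "\<exists>U. open U \<and> U \<inter> (X \<times> X) = {z \<in> X \<times> X. q (fst z) \<noteq> q (snd z)}"
        by (intro exI[of _ U]) auto
    qed
    from bchoice[OF this] obtain U where U: "\<And>q. q \<in> \<Phi> \<Longrightarrow> open (U q)"
       "\<And>q. q \<in> \<Phi> \<Longrightarrow> U q \<inter> (X \<times> X) = {z \<in> X \<times> X. q (fst z) \<noteq> q (snd z)}"
      by blast
    have "C \<subseteq> (\<Union>q\<in>\<Phi>. U q)"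
    proof
      fix z assume z: "z \<in> C"
      then have "z \<notin> K" by (auto simp: C_def divide_le_0_iff)
      then obtain q where "q \<in> \<Phi>" "q (fst z) \<noteq> q (snd z)" using z by (auto simp: K_def C_def)
      then show "z \<in> (\<Union>q\<in>\<Phi>. U q)" using U(2)[of q] z by (auto simp: C_def)
    qed
    then obtain A where A: "A \<subseteq> \<Phi>" "finite A" "C \<subseteq> (\<Union>q\<in>A. U q)"
      using compactE_image[OF cC] U(1) by metis
    show "\<exists>A. finite A \<and> A \<subseteq> \<Phi> \<and>
      (\<forall>z\<in>X \<times> X. infdist z K \<ge> 1 / real (Suc i) \<longrightarrow> (\<exists>q\<in>A. q (fst z) \<noteq> q (snd z)))"
    proof (intro exI conjI ballI impI)
      show "finite A" "A \<subseteq> \<Phi>" using A by auto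
      fix z assume z: "z \<in> X \<times> X" "infdist z K \<ge> 1 / real (Suc i)"
      then have "z \<in> C" by (simp add: C_def)
      then obtain q where q: "q \<in> A" "z \<in> U q" using A(3) by auto
      then have "z \<in> U q \<inter> (X \<times> X)" using z by simp
      then show "\<exists>q\<in>A. q (fst z) \<noteq> q (snd z)" using U(2)[of q] A(1) q by auto
    qed
  qed
  from choice[OF this] obtain A where A: "\<And>i. finite (A i)" "\<And>i. A i \<subseteq> \<Phi>"
     "\<And>i z. z \<in> X \<times> X \<Longrightarrow> infdist z K \<ge> 1 / real (Suc i) \<Longrightarrow> \<exists>q\<in>A i. q (fst z) \<noteq> q (snd z)"
    by blast
  define B where "B = insert (\<lambda>_ _. 0) (\<Union>i. A i)"
  have "countable B" unfolding B_def using A(1) by (auto intro: countable_finite)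
  moreover have "B \<noteq> {}" by (simp add: B_def)
  ultimately have B: "range (from_nat_into B) = B" by (simp add: range_from_nat_into)
  have B\<Phi>: "B \<subseteq> \<Phi>" using A(2) const by (auto simp: B_def)
  have clK: "closed K"
  proof -
    have "closed {z \<in> X \<times> X. q (fst z) = q (snd z)}" if "q \<in> \<Phi>" for q
    proof -
      have f: "continuous_on (X \<times> X) (\<lambda>z. dist (q (fst z)) (q (snd z)))"
        by (intro continuous_on_dist continuous_on_compose2[OF cont[OF that]])
          (auto intro: continuous_intros)
      have "closed (X \<times> X)" using X'(1) by (simp add: closed_Times compact_imp_closed)
      then have "closed ((\<lambda>z. dist (q (fst z)) (q (snd z))) -` {0} \<inter> (X \<times> X))"
        using f continuous_on_closed_vimage by blast
      moreover have "(\<lambda>z. dist (q (fst z)) (q (snd z))) -` {0} \<inter> (X \<times> X) =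
          {z \<in> X \<times> X. q (fst z) = q (snd z)}" by auto
      ultimately show ?thesis by simp
    qed
    moreover have "K = (\<Inter>q\<in>\<Phi>. {z \<in> X \<times> X. q (fst z) = q (snd z)})"
      using const by (auto simp: K_def)
    ultimately show ?thesis by auto
  qed
  have BK: "q x = q y" if xy: "x \<in> X" "y \<in> X" and b: "\<And>b. b \<in> B \<Longrightarrow> b x = b y" and q: "q \<in> \<Phi>" for x y q
  proof (rule ccontr)
    assume "q x \<noteq> q y"
    then have "(x, y) \<notin> K" using q by (auto simp: K_def)
    moreover have "K \<noteq> {}" using xy(1) by (auto simp: K_def)
    ultimately have "infdist (x, y) K > 0"
      using clK in_closed_iff_infdist_zero[of K "(x, y)"] infdist_nonneg[of "(x, y)" K] by linarith
    then obtain i where "1 / real (Suc i) < infdist (x, y) K" using nat_approx_posE by blast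
    then obtain q' where "q' \<in> A i" "q' x \<noteq> q' y" using A(3)[of "(x, y)" i] xy by auto
    then show False using b by (auto simp: B_def)
  qed
  define P where "P x j = from_nat_into B (fst (prod_decode j)) x (snd (prod_decode j))" for x j
  have PB: "P x = P y \<longleftrightarrow> (\<forall>b\<in>B. b x = b y)" for x y
  proof
    assume e: "P x = P y"
    show "\<forall>b\<in>B. b x = b y"
    proof
      fix b assume "b \<in> B"
      then obtain m where m: "b = from_nat_into B m" using B by blast
      show "b x = b y"
      proof
        fix l show "b x l = b y l"
          using fun_cong[OF e, of "prod_encode (m, l)"] by (simp add: P_def m)
      qed
    qed
  next
    assume "\<forall>b\<in>B. b x = b y"
    moreover have "from_nat_into B m \<in> B" for m using B by blast
    ultimately show "P x = P y" by (auto simp: P_def fun_eq_iff)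
  qed
  have cP: "continuous_on X P"
  proof (rule continuous_on_coordinatewise_then_product)
    fix j
    have "from_nat_into B (fst (prod_decode j)) \<in> \<Phi>" using B B\<Phi> by blast
    from continuous_on_product_then_coordinatewise[OF cont[OF this]]
    show "continuous_on X (\<lambda>x. P x j)" unfolding P_def .
  qed
  have \<Phi>T: "q (T x) = q (T y) \<longleftrightarrow> q x = q y" if "q \<in> \<Phi>" "x \<in> X" "y \<in> X" for q x y
  proof -
    obtain F Q where "equicontinuous_system F Q" and q: "factor_map X T F Q q"
      using \<open>q \<in> \<Phi>\<close> by (auto simp: \<Phi>_def)
    then have "inj_on Q F"
      using dynamical_systemD(3) unfolding equicontinuous_system_def bij_betw_def by blast
    moreover have "q x \<in> F" "q y \<in> F" "q (T x) = Q (q x)" "q (T y) = Q (q y)"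
      using q that by (auto simp: factor_map_def)
    ultimately show ?thesis by (simp add: inj_on_eq_iff)
  qed
  have "P (T x) = P (T y) \<longleftrightarrow> P x = P y" if "x \<in> X" "y \<in> X" for x y
    unfolding PB using \<Phi>T[OF subsetD[OF B\<Phi>] that] by simp
  then obtain R where R: "dynamical_system (P ` X) R" "factor_map X T (P ` X) R P"
    using quotient_system[OF X cP] by metis
  have lift: "\<exists>h. factor_map (P ` X) R F Q h \<and> (\<forall>x\<in>X. q x = h (P x))"
    if F: "equicontinuous_system F Q" and q: "factor_map X T F Q q"
    for F :: "(nat \<Rightarrow> real) set" and Q q
  proof -
    have q\<Phi>: "q \<in> \<Phi>" using F q by (auto simp: \<Phi>_def)
    define h where "h = q \<circ> inv_into X P"
    have h: "h (P x) = q x" if "x \<in> X" for x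
    proof -
      have "inv_into X P (P x) \<in> X" "P (inv_into X P (P x)) = P x"
        using that by (auto simp: inv_into_into f_inv_into_f)
      then show ?thesis using BK[of "inv_into X P (P x)" x q] that q\<Phi> by (auto simp: h_def PB)
    qed
    have qm: "quotient_map (top_of_set X) (top_of_set (P ` X)) P"
      using cP X' by (intro T1_Spaces.continuous_imp_quotient_map)
        (auto simp: compact_space_subtopology Hausdorff_space_subtopology)
    have "continuous_on X (h \<circ> P)"
      using cont[OF q\<Phi>] by (rule continuous_on_eq) (simp add: h)
    then have "continuous_on (P ` X) h"
      using continuous_compose_quotient_map[OF qm, of euclidean h] by simp
    moreover have "h ` P ` X = F" using q h by (force simp: factor_map_def image_image)
    moreover have "h (R (P x)) = Q (h (P x))" if "x \<in> X" for x
    proof -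
      have "R (P x) = P (T x)" using R(2) that by (simp add: factor_map_def)
      then show ?thesis using h that TX q by (simp add: factor_map_def)
    qed
    ultimately show ?thesis using h by (auto simp: factor_map_def)
  qed
  have sep: "\<exists>(F :: (nat \<Rightarrow> real) set) Q r.
      equicontinuous_system F Q \<and> factor_map (P ` X) R F Q r \<and> r a \<noteq> r b"
    if ab: "a \<in> P ` X" "b \<in> P ` X" "a \<noteq> b" for a b
  proof -
    obtain x y where xy: "x \<in> X" "y \<in> X" "a = P x" "b = P y" using ab by auto
    then have "P x \<noteq> P y" using ab(3) by simp
    then obtain q where q: "q \<in> B" "q x \<noteq> q y" unfolding PB by blast
    have "q \<in> \<Phi>" using q(1) B\<Phi> by (rule subsetD[rotated])
    then obtain F Q where F: "equicontinuous_system F Q" "factor_map X T F Q q"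
      unfolding \<Phi>_def by blast
    obtain h where h: "factor_map (P ` X) R F Q h" "\<forall>x\<in>X. q x = h (P x)"
      using lift[OF F] by blast
    have "h a = q x" "h b = q y" using h(2) xy by simp_all
    then have "h a \<noteq> h b" using q(2) by simp
    then show ?thesis using F(1) h(1) by blast
  qed
  have eqc: "equicontinuous_system (P ` X) R"
    by (rule equicontinuous_if_separated[OF R(1) sep])
  have "max_equicontinuous_factor X T (P ` X) R P"
    unfolding max_equicontinuous_factor_def
  proof (intro conjI allI impI)
    show "equicontinuous_system (P ` X) R" by (rule eqc)
    show "factor_map X T (P ` X) R P" by (rule R(2))
    fix F :: "(nat \<Rightarrow> real) set" and Q q
    assume "equicontinuous_system F Q \<and> factor_map X T F Q q"
    then show "\<exists>h. factor_map (P ` X) R F Q h \<and> (\<forall>x\<in>X. q x = h (P x))"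
      by (elim conjE) (rule lift)
  qed
  then show ?thesis by blast
qed

end

theory Submission
  imports Defs "HOL-Probability.Discrete_Topology"
begin

text \<open>
  For minimal \<open>X\<close>, \<open>Z\<close> and a closed invariant \<open>N \<subseteq> X \<times> Z\<close> the content of the symmetric difference of
  the sections \<open>N\<^sub>x\<close>, \<open>N\<^sub>x'\<close>, taken with respect to an invariant mean on \<open>Z\<close>, is a continuous
  invariant pseudometric on \<open>X\<close>, so it vanishes on the fibres of \<open>X \<rightarrow> X\<^sub>e\<^sub>q\<close> (McMahon). Using this in
  both coordinates, \<open>N\<close> contains the whole fibre over \<open>X\<^sub>e\<^sub>q \<times> Z\<^sub>e\<^sub>q\<close> of every interior point
  \<open>(x, z)\<close> with \<open>z\<close> generic.

  Let \<open>J\<close> be a proper joining of \<open>X\<close> and \<open>Z\<close> that covers \<open>X\<^sub>e\<^sub>q \<times> Z\<^sub>e\<^sub>q\<close>. The fibres that are not contained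
  in \<open>J\<close> include all those over a closed invariant set with nonempty interior; let \<open>H\<close> be the part of
  \<open>J\<close> above this set. Quasi-disjointness of \<open>Y\<close> and \<open>Z\<close> shows that the \<open>G\<close>-translates of \<open>H\<close> cover a
  nonempty open set. Cutting \<open>G\<close> into finitely many small pieces, Baire's theorem and the first
  paragraph give a fibre which for every \<open>\<epsilon>\<close> lies in a translate of \<open>H\<close> up to an \<open>\<epsilon>\<close>-small motion in
  \<open>G\<close>, so by compactness of \<open>G\<close> it lies in a single translate. Hence \<open>H\<close> contains a whole fibre, a
  contradiction.
\<close>

section \<open>Minimal systems\<close>

lemma compact_subset_closed:
  assumes "closed N" "N \<subseteq> W" "compact W"
  shows "compact N"
  using assms by (metis compact_Int_closed inf.absorb_iff2)

section \<open>Integer iterates of a homeomorphism\<close>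

lemma zpow_0 [simp]: "zpow X T 0 x = x"
  by (simp add: zpow_def)

lemma zpow_of_nat [simp]: "zpow X T (int k) x = (T ^^ k) x"
  by (simp add: zpow_def)

lemma zpow_Suc:
  assumes X: "dynamical_system X T" and x: "x \<in> X"
  shows "zpow X T (n + 1) x = T (zpow X T n x)"
proof (cases "0 \<le> n")
  case True
  then show ?thesis by (simp add: zpow_def nat_add_distrib)
next
  case False
  define k where "k = nat (- (n + 1))"
  have n: "n = - int (Suc k)" using False by (simp add: k_def)
  have nk: "nat (- n) = Suc k" using False by (simp add: k_def)
  have b: "bij_betw T X X" using dynamical_systemD[OF X] by simp
  have z: "zpow X T n x = inv_into X T ((inv_into X T ^^ k) x)" using False by (simp add: zpow_def nk)
  have k': "(inv_into X T ^^ k) x = zpow X T (- int k) x"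
    by (cases "k = 0") (simp_all add: zpow_def)
  then have "(inv_into X T ^^ k) x \<in> X" using zpow_closed[OF X x] by simp
  then have "T (zpow X T n x) = (inv_into X T ^^ k) x"
    using b by (simp add: z bij_betw_inv_into_right)
  also have "\<dots> = zpow X T (n + 1) x" by (simp add: k' n)
  finally show ?thesis by simp
qed

lemma zpow_pred:
  assumes X: "dynamical_system X T" and x: "x \<in> X"
  shows "zpow X T (n - 1) x = inv_into X T (zpow X T n x)"
proof -
  have "T (zpow X T (n - 1) x) = zpow X T n x" using zpow_Suc[OF assms, of "n - 1"] by simp
  then show ?thesis
    using dynamical_systemD(3)[OF X] zpow_closed[OF assms] by (metis bij_betw_inv_into_left)
qed

lemma zpow_add:
  assumes X: "dynamical_system X T" and x: "x \<in> X"
  shows "zpow X T (m + n) x = zpow X T m (zpow X T n x)"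
proof (induction m rule: int_induct[where k = 0])
  case base
  then show ?case by simp
next
  case (step1 i)
  have "zpow X T (i + 1 + n) x = zpow X T ((i + n) + 1) x" by (simp add: algebra_simps)
  then show ?case using step1 zpow_Suc[OF X] x zpow_closed[OF X x] by simp
next
  case (step2 i)
  have "zpow X T (i - 1 + n) x = zpow X T ((i + n) - 1) x" by (simp add: algebra_simps)
  then show ?case using step2 zpow_pred[OF X] x zpow_closed[OF X x] by simp
qed

lemma zpow_uminus_cancel:
  assumes "dynamical_system X T" "x \<in> X"
  shows "zpow X T (- n) (zpow X T n x) = x"
  using zpow_add[OF assms, of "- n" n] by simp

lemma zpow_Suc_right:
  assumes "dynamical_system X T" "x \<in> X"
  shows "zpow X T n (T x) = zpow X T (n + 1) x"
  using zpow_add[OF assms, of n 1] by (simp add: zpow_def)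

lemma continuous_on_zpow:
  assumes X: "dynamical_system X T"
  shows "continuous_on X (zpow X T n)"
proof (induction n rule: int_induct[where k = 0])
  case base
  then show ?case by (simp add: zpow_def id_def)
next
  case (step1 i)
  have "continuous_on X (\<lambda>x. T (zpow X T i x))"
    by (rule continuous_on_compose2[OF dynamical_systemD(2)[OF X] step1(2)])
      (use zpow_closed[OF X] in auto)
  then show ?case by (rule continuous_on_eq) (simp add: zpow_Suc[OF X])
next
  case (step2 i)
  obtain T' where T': "homeomorphism X X T T'" using X by (auto simp: dynamical_system_def)
  have "inv_into X T y = T' y" if "y \<in> X" for y
  proof -
    have "T (T' y) = y" "T' y \<in> X" using T' that by (auto simp: homeomorphism_def)
    then show ?thesis
      using dynamical_systemD(3)[OF X] by (metis bij_betw_inv_into_left)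
  qed
  then have c: "continuous_on X (inv_into X T)"
    using T' by (auto simp: homeomorphism_def cong: continuous_on_cong)
  have "continuous_on X (\<lambda>x. inv_into X T (zpow X T i x))"
    by (rule continuous_on_compose2[OF c step2(2)]) (use zpow_closed[OF X] in auto)
  then show ?case by (rule continuous_on_eq) (simp add: zpow_pred[OF X])
qed

lemma funpow_closed:
  assumes "dynamical_system X T" "x \<in> X"
  shows "(T ^^ k) x \<in> X"
  using zpow_closed[OF assms, of "int k"] by simp

text \<open>Links the set equation in \<open>joining\<close> with pointwise invariance; the
  pointwise form passes at once to intersections, unions and complements, which is how invariant
  sets are built later.\<close>

lemma image_eq_iff_invariant:
  assumes "bij_betw f W W" "N \<subseteq> W"
  shows "f ` N = N \<longleftrightarrow> (\<forall>w\<in>W. f w \<in> N \<longleftrightarrow> w \<in> N)"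
proof
  assume "f ` N = N"
  then show "\<forall>w\<in>W. f w \<in> N \<longleftrightarrow> w \<in> N"
    using assms unfolding bij_betw_def inj_on_def by (metis image_iff subsetD)
next
  assume *: "\<forall>w\<in>W. f w \<in> N \<longleftrightarrow> w \<in> N"
  show "f ` N = N"
  proof
    show "f ` N \<subseteq> N" using * assms(2) by auto
    show "N \<subseteq> f ` N"
    proof
      fix w assume w: "w \<in> N"
      then obtain v where "v \<in> W" "w = f v" using assms by (auto simp: bij_betw_def)
      then show "w \<in> f ` N" using * w by auto
    qed
  qed
qed

text \<open>Compactness gives finitely many integers \<open>n\<close> such that the preimages of
  \<open>U\<close> under the \<open>n\<close>-th iterates cover \<open>X\<close>. Applying
  \<open>T\<close> first \<open>m\<close> times, where \<open>m\<close> bounds all absolute values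
  of these integers, turns them into forward times between 0 and \<open>2 * m\<close>.\<close>

lemma minimal_return:
  assumes m: "minimal_system X T" and U: "open U" "U \<inter> X \<noteq> {}"
  shows "\<exists>M. \<forall>x\<in>X. \<exists>k\<le>M. (T ^^ k) x \<in> U"
proof -
  have X: "dynamical_system X T" using m by (simp add: minimal_system_def)
  have "\<forall>n. \<exists>V. open V \<and> V \<inter> X = zpow X T n -` U \<inter> X"
    using continuous_on_zpow[OF X] U(1) by (auto simp: continuous_on_open_invariant)
  then obtain V where V: "\<And>n. open (V n)" "\<And>n. V n \<inter> X = zpow X T n -` U \<inter> X" by metis
  have "X \<subseteq> (\<Union>n\<in>UNIV. V n)"
  proof
    fix x assume x: "x \<in> X"
    obtain u where u: "u \<in> U" "u \<in> X" using U(2) by blast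
    have sub: "X \<subseteq> closure (range (\<lambda>n. zpow X T n x))"
      using m x unfolding minimal_system_def by (elim conjE) (rule bspec)
    have "u \<in> closure (range (\<lambda>n. zpow X T n x))"
      using sub u(2) by (rule subsetD)
    then obtain n where "zpow X T n x \<in> U"
      using U(1) u(1) unfolding closure_iff_nhds_not_empty by blast
    then show "x \<in> (\<Union>n\<in>UNIV. V n)" using V(2)[of n] x by auto
  qed
  then obtain I where I: "finite I" "X \<subseteq> (\<Union>n\<in>I. V n)"
    by (rule compactE_image[OF dynamical_systemD(1)[OF X] V(1)]) (rule that)
  define m where "m = nat (Max (abs ` (insert 0 I)))"
  have m: "\<bar>n\<bar> \<le> int m" if "n \<in> I" for n
  proof -
    have "\<bar>n\<bar> \<le> Max (abs ` (insert 0 I))" using I(1) that by (intro Max_ge) auto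
    then show ?thesis using abs_ge_zero[of n] unfolding m_def by linarith
  qed
  have "\<exists>k\<le>2 * m. (T ^^ k) x \<in> U" if x: "x \<in> X" for x
  proof -
    have y: "zpow X T (int m) x \<in> X" using zpow_closed[OF X x] .
    then obtain n where "n \<in> I" "zpow X T (int m) x \<in> V n" using I(2) by blast
    then have n: "n \<in> I" "zpow X T n (zpow X T (int m) x) \<in> U"
      using V(2)[of n] y by blast+
    then have "zpow X T (n + int m) x \<in> U" using zpow_add[OF X x] by simp
    moreover have "0 \<le> n + int m" "n + int m \<le> 2 * int m" using m[OF n(1)] by auto
    ultimately show ?thesis
      by (intro exI[of _ "nat (n + int m)"]) (auto simp: zpow_def)
  qed
  then show ?thesis by blast
qed

text \<open>Since \<open>minimal_return\<close> yields forward times, an orbit starting in a forward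
  invariant proper \<open>A\<close> would have to enter the complement of \<open>A\<close>.\<close>

lemma minimal_invariant_closed:
  assumes m: "minimal_system X T" and A: "closed A" "A \<subseteq> X" "T ` A \<subseteq> A" "A \<noteq> {}"
  shows "A = X"
proof (rule ccontr)
  assume "A \<noteq> X"
  then obtain M where M: "\<forall>x\<in>X. \<exists>k\<le>M. (T ^^ k) x \<in> - A"
    using minimal_return[OF m, of "- A"] A by blast
  obtain a where a: "a \<in> A" using A by blast
  have "(T ^^ k) a \<in> A" for k by (induction k) (use a A in auto)
  then show False using M a A by blast
qed

lemma open_image_homeomorphism:
  assumes E: "dynamical_system E R" and V: "openin (top_of_set E) V"
  shows "openin (top_of_set E) ((R ^^ k) ` V)"
proof (induction k)
  case 0
  then show ?case using V by simp
next
  case (Suc k)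
  obtain R' where "homeomorphism E E R R'" using E by (auto simp: dynamical_system_def)
  from homeomorphism_imp_open_map[OF this Suc] show ?case by (simp add: image_comp)
qed

text \<open>Bounded return times to a small closed ball inside \<open>U\<close> give finitely many
  compact sets \<open>A k\<close> covering \<open>X\<close>. Their images cover \<open>E\<close>, so
  by Baire one image has interior, and \<open>R ^^ k\<close> moves that interior into the image of
  \<open>U\<close>. Factor maps of minimal systems are thus semi-open.\<close>

lemma minimal_factor_semiopen:
  assumes m: "minimal_system X T" and E: "dynamical_system E R"
    and p: "factor_map X T E R p" and U: "open U" "U \<inter> X \<noteq> {}"
  shows "\<exists>V. open V \<and> V \<inter> E \<noteq> {} \<and> V \<inter> E \<subseteq> p ` (U \<inter> X)"
proof -
  have X: "dynamical_system X T" using m by (simp add: minimal_system_def)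
  have cp: "continuous_on X p" and pX: "p ` X = E" using p by (auto simp: factor_map_def)
  obtain x where x: "x \<in> U" "x \<in> X" using U by blast
  then obtain r where r: "r > 0" "cball x r \<subseteq> U" using U(1) open_contains_cball by blast
  have "x \<in> ball x r" using r(1) by simp
  then have "ball x r \<inter> X \<noteq> {}" using x(2) by blast
  from minimal_return[OF m open_ball this]
  obtain M where M: "\<forall>x'\<in>X. \<exists>k\<le>M. (T ^^ k) x' \<in> ball x r" ..
  define A where "A k = {x' \<in> X. (T ^^ k) x' \<in> cball x r}" for k
  have cA: "compact (A k)" for k
  proof -
    have "continuous_on X (\<lambda>x'. zpow X T (int k) x')"
      using continuous_on_zpow[OF X, of "int k"] by (simp cong: continuous_on_cong)
    then have "continuous_on X (T ^^ k)" by simp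
    then have "closedin (top_of_set X) (X \<inter> (T ^^ k) -` cball x r)"
      by (rule continuous_closedin_preimage) simp
    moreover have "X \<inter> (T ^^ k) -` cball x r = A k" by (auto simp: A_def)
    ultimately show ?thesis using closedin_compact dynamical_systemD(1)[OF X] by metis
  qed
  have clos: "closedin (top_of_set E) (p ` A k)" for k
  proof -
    have "compact (p ` A k)"
      using continuous_on_subset[OF cp] cA by (intro compact_continuous_image) (auto simp: A_def)
    moreover have "p ` A k \<subseteq> E" using pX by (auto simp: A_def)
    ultimately show ?thesis by (simp add: closed_subset compact_imp_closed)
  qed
  have cov: "E = (\<Union>k\<in>{..M}. p ` A k)"
  proof
    show "E \<subseteq> (\<Union>k\<in>{..M}. p ` A k)"
    proof
      fix e assume "e \<in> E"
      then obtain x' where x': "x' \<in> X" "e = p x'" using pX by blast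
      then obtain k where "k \<le> M" "(T ^^ k) x' \<in> ball x r" using M by blast
      then have "x' \<in> A k" "k \<in> {..M}" using x'(1) by (auto simp: A_def)
      then show "e \<in> (\<Union>k\<in>{..M}. p ` A k)" using x'(2) by blast
    qed
  qed (use pX in \<open>auto simp: A_def\<close>)
  have "\<exists>k\<le>M. top_of_set E interior_of (p ` A k) \<noteq> {}"
  proof (rule ccontr)
    assume "\<not> ?thesis"
    then have no: "\<forall>k\<in>{..M}. top_of_set E interior_of (p ` A k) = {}" by auto
    have "compact E" using dynamical_systemD(1)[OF E] .
    then have "locally_compact_space (top_of_set E)" "regular_space (top_of_set E)"
      by (auto simp: compact_imp_locally_compact_space compact_space_subtopology
          metrizable_imp_regular_space metrizable_space_subtopology metrizable_space_euclidean)
    then have "top_of_set E interior_of \<Union>((\<lambda>k. p ` A k) ` {..M}) = {}"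
      using clos no by (intro Baire_category_alt) auto
    then have "E = {}" using cov interior_of_topspace[of "top_of_set E"] by simp
    then show False using pX x by auto
  qed
  then obtain k where k: "top_of_set E interior_of (p ` A k) \<noteq> {}" by blast
  define V where "V = (R ^^ k) ` (top_of_set E interior_of (p ` A k))"
  have "openin (top_of_set E) V"
    unfolding V_def by (rule open_image_homeomorphism[OF E]) simp
  then obtain V' where V': "open V'" "V = E \<inter> V'" by (auto simp: openin_open)
  have "V \<subseteq> p ` (U \<inter> X)"
  proof
    fix v assume "v \<in> V"
    then obtain x' where x': "x' \<in> A k" "v = (R ^^ k) (p x')"
      using interior_of_subset[of "top_of_set E" "p ` A k"] unfolding V_def by auto
    then have "x' \<in> X" by (auto simp: A_def)
    then have "v = p ((T ^^ k) x')"
      using factor_map_zpow[OF X E p, of x' "int k"] x'(2) by simp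
    then show "v \<in> p ` (U \<inter> X)"
      using x'(1) r(2) funpow_closed[OF X] by (auto simp: A_def)
  qed
  moreover have "V \<noteq> {}" using k by (simp add: V_def)
  ultimately show ?thesis using V' by (intro exI[of _ V']) (auto simp: Int_commute)
qed

section \<open>Invariant means and their contents\<close>

text \<open>A finitely additive probability carried by \<open>Z\<close>, with additivity in modular
  form. It is defined on every subset, so that it can be found as a cluster point in a cube.\<close>

definition invariant_mean :: "'a set \<Rightarrow> ('a \<Rightarrow> 'a) \<Rightarrow> ('a set \<Rightarrow> real) \<Rightarrow> bool" where
  "invariant_mean Z S m \<longleftrightarrow>
     (\<forall>A. 0 \<le> m A) \<and> (\<forall>A B. A \<subseteq> B \<longrightarrow> m A \<le> m B) \<and>
     (\<forall>A B. m (A \<union> B) + m (A \<inter> B) = m A + m B) \<and>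
     (\<forall>A. m (S -` A) = m A) \<and> m {} = 0 \<and> m Z = 1 \<and> (\<forall>A. m (A \<inter> Z) = m A)"

section \<open>Existence of invariant means\<close>

lemma cluster_point_in_closed:
  fixes m :: "'a::topological_space"
  assumes cluster: "inf (nhds m) F \<noteq> bot" and S: "closed S" "eventually (\<lambda>x. x \<in> S) F"
  shows "m \<in> S"
proof (rule ccontr)
  assume "m \<notin> S"
  then have "eventually (\<lambda>x. x \<in> - S) (nhds m)"
    using S(1) by (intro eventually_nhds_in_open) auto
  then have "eventually (\<lambda>x. False) (inf (nhds m) F)"
    using S(2) unfolding eventually_inf by blast
  then show False using cluster by (simp add: trivial_limit_def)
qed

text \<open>The averages of point masses along the orbit of \<open>x\<close> lie in a compact cube
  of set functions with values in \<open>{0..1}\<close>. A cluster point inherits every closed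
  relation that the averages satisfy exactly or asymptotically.\<close>

lemma invariant_mean_exists:
  assumes Z: "x \<in> Z" "S ` Z \<subseteq> Z"
  obtains m where "invariant_mean Z S m"
proof -
  define N where "N n A = (\<Sum>k<Suc n. indicator A ((S ^^ k) x)) / real (Suc n)"
    for n and A :: "'a set"
  define F where "F = filtermap N sequentially"
  have orb: "(S ^^ k) x \<in> Z" for k by (induction k) (use Z in auto)
  have N0: "0 \<le> N n A" for n A unfolding N_def by (intro divide_nonneg_nonneg sum_nonneg) auto
  have Nmono: "N n A \<le> N n B" if "A \<subseteq> B" for n A B
    unfolding N_def using that
    by (intro divide_right_mono sum_mono) (auto simp: indicator_def)
  have N1: "N n A = 1" if "Z \<subseteq> A" for n A
  proof -
    have "indicator A ((S ^^ k) x) = (1 :: real)" for k using orb that by (auto simp: indicator_def)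
    then show ?thesis by (simp add: N_def)
  qed
  have Nle: "N n A \<le> 1" for n A using Nmono[of A UNIV n] N1[of UNIV n] by simp
  have Nmod: "N n (A \<union> B) + N n (A \<inter> B) = N n A + N n B" for n A B
  proof -
    have "indicator (A \<union> B) y + indicator (A \<inter> B) y = (indicator A y + indicator B y :: real)" for y
      by (auto simp: indicator_def)
    then show ?thesis
      unfolding N_def add_divide_distrib[symmetric] sum.distrib[symmetric] by simp
  qed
  have Ninv: "\<bar>N n (S -` A) - N n A\<bar> \<le> 1 / real (Suc n)" for n A
  proof -
    \<comment> \<open>Passing to the preimage shifts the summation index by one, so the two sums
      differ only in the boundary terms.\<close>
    define i where "i k = (indicator A ((S ^^ k) x) :: real)" for k
    have i: "0 \<le> i k" "i k \<le> 1" for k by (auto simp: i_def indicator_def)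
    have "(\<Sum>k<Suc n. indicator (S -` A) ((S ^^ k) x)) = (\<Sum>k<Suc n. i (Suc k))"
      by (simp add: i_def indicator_def)
    also have "\<dots> = (\<Sum>k<Suc n. i k) + (i (Suc n) - i 0)"
      using sum.lessThan_Suc_shift[of i "Suc n"] by simp
    finally have "N n (S -` A) - N n A = (i (Suc n) - i 0) / real (Suc n)"
      unfolding N_def i_def by (simp add: add_divide_distrib)
    also have "\<bar>\<dots>\<bar> \<le> 1 / real (Suc n)"
      using i[of "Suc n"] i[of 0] by (auto simp: abs_divide intro!: divide_right_mono)
    finally show ?thesis .
  qed
  define K where "K = Pi\<^sub>E (UNIV :: 'a set set) (\<lambda>_. {0..1::real})"
  have "compactin (product_topology (\<lambda>_. euclidean) UNIV) K"
    unfolding K_def compactin_PiE by simp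
  then have "compact K" by (simp add: euclidean_product_topology)
  moreover have "eventually (\<lambda>\<mu>. \<mu> \<in> K) F" "F \<noteq> bot"
    using N0 Nle by (simp_all add: F_def K_def eventually_filtermap filtermap_bot_iff PiE_iff)
  ultimately obtain m where m: "inf (nhds m) F \<noteq> bot" unfolding compact_filter by blast
  have cl: "m \<in> P" if "closed P" "eventually (\<lambda>n. N n \<in> P) sequentially" for P
    by (rule cluster_point_in_closed[OF m that(1)]) (use that(2) in \<open>simp add: F_def eventually_filtermap\<close>)
  have co: "continuous_on UNIV (\<lambda>\<mu> :: 'a set \<Rightarrow> real. \<mu> A)" for A by simp
  have eq: "f m = g m"
    if "continuous_on UNIV f" "continuous_on UNIV g" "\<And>n. f (N n) = g (N n)"
    for f g :: "('a set \<Rightarrow> real) \<Rightarrow> real"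
    using cl[of "{\<mu>. f \<mu> = g \<mu>}"] that by (auto intro: closed_Collect_eq)
  have le: "f m \<le> g m"
    if "continuous_on UNIV f" "continuous_on UNIV g" "eventually (\<lambda>n. f (N n) \<le> g (N n)) sequentially"
    for f g :: "('a set \<Rightarrow> real) \<Rightarrow> real"
    using cl[of "{\<mu>. f \<mu> \<le> g \<mu>}"] that by (auto intro: closed_Collect_le)
  have m0: "0 \<le> m A" for A
    by (rule le[of "\<lambda>_. 0" "\<lambda>\<mu>. \<mu> A"]) (auto intro: co simp: N0)
  have mmono: "m A \<le> m B" if "A \<subseteq> B" for A B
    by (rule le[of "\<lambda>\<mu>. \<mu> A" "\<lambda>\<mu>. \<mu> B"]) (auto intro: co simp: Nmono that)
  have mmod: "m (A \<union> B) + m (A \<inter> B) = m A + m B" for A B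
    by (rule eq[of "\<lambda>\<mu>. \<mu> (A \<union> B) + \<mu> (A \<inter> B)" "\<lambda>\<mu>. \<mu> A + \<mu> B"])
      (auto intro!: co continuous_on_add simp: Nmod)
  have m1: "m A = 1" if "Z \<subseteq> A" for A
    by (rule eq[of "\<lambda>\<mu>. \<mu> A" "\<lambda>_. 1"]) (auto intro: co simp: N1 that)
  have me: "m {} = 0"
    by (rule eq[of "\<lambda>\<mu>. \<mu> {}" "\<lambda>_. 0"]) (auto intro: co simp: N_def)
  have minv: "m (S -` A) = m A" for A
  proof -
    have "\<bar>m (S -` A) - m A\<bar> \<le> e" if e: "e > 0" for e
    proof (rule le[of "\<lambda>\<mu>. \<bar>\<mu> (S -` A) - \<mu> A\<bar>" "\<lambda>_. e"])
      obtain n0 where n0: "1 / real (Suc n0) < e" by (rule nat_approx_posE[OF e])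
      show "eventually (\<lambda>n. \<bar>N n (S -` A) - N n A\<bar> \<le> e) sequentially"
      proof (rule eventually_sequentiallyI[of n0])
        fix n assume "n0 \<le> n"
        then have "1 / real (Suc n) \<le> 1 / real (Suc n0)" by (simp add: frac_le)
        then show "\<bar>N n (S -` A) - N n A\<bar> \<le> e" using Ninv[of n A] n0 by linarith
      qed
      show "continuous_on UNIV (\<lambda>\<mu> :: 'a set \<Rightarrow> real. \<bar>\<mu> (S -` A) - \<mu> A\<bar>)"
        using continuous_on_diff[OF co co] by (rule continuous_on_rabs)
      show "continuous_on UNIV (\<lambda>\<mu> :: 'a set \<Rightarrow> real. e)" by simp
    qed
    then have "\<bar>m (S -` A) - m A\<bar> \<le> 0" by (meson dense_ge)
    then show ?thesis by simp
  qed
  have "m (A \<inter> Z) = m A" for A using mmod[of A Z] m1[of Z] m1[of "A \<union> Z"] by simp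
  then have "invariant_mean Z S m"
    unfolding invariant_mean_def using m0 mmono mmod minv me m1[of Z] by auto
  then show thesis by (rule that)
qed

text \<open>Passing to open supersets builds in upper semicontinuity: a strict upper bound for
  \<open>C\<close> persists for all subsets of some neighbourhood of \<open>C\<close>.\<close>

definition outer_content :: "('a::topological_space set \<Rightarrow> real) \<Rightarrow> 'a set \<Rightarrow> real" where
  "outer_content m C = (INF V\<in>{V. open V \<and> C \<subseteq> V}. m V)"

section \<open>Submodularity, invariance and positivity of the outer content\<close>

lemma outer_content_le:
  assumes "invariant_mean Z S m" "open V" "C \<subseteq> V"
  shows "outer_content m C \<le> m V"
  unfolding outer_content_def
  using assms by (intro cINF_lower) (auto simp: invariant_mean_def bdd_below_def)

lemma outer_content_ge:
  assumes "\<And>V. open V \<Longrightarrow> C \<subseteq> V \<Longrightarrow> c \<le> m V"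
  shows "c \<le> outer_content m C"
  unfolding outer_content_def using assms by (intro cINF_greatest) auto

lemma outer_content_less:
  assumes "outer_content m C < a"
  obtains V where "open V" "C \<subseteq> V" "m V < a"
  using outer_content_ge[of C a m] assms by (meson not_less)

lemma outer_content_mono:
  assumes "invariant_mean Z S m" "C \<subseteq> D"
  shows "outer_content m C \<le> outer_content m D"
  using assms by (intro outer_content_ge outer_content_le) auto

text \<open>Nearly optimal open supersets \<open>V\<close> and \<open>W\<close> have a union and an
  intersection that are admissible for those of \<open>A\<close> and \<open>B\<close>, and
  \<open>m\<close> is modular. This becomes the triangle inequality of the pseudometric.\<close>

lemma outer_content_submodular:
  assumes m: "invariant_mean Z S m"
  shows "outer_content m (A \<union> B) + outer_content m (A \<inter> B) \<le> outer_content m A + outer_content m B"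
proof (rule field_le_epsilon)
  fix e :: real assume "e > 0"
  then have e: "C < C + e / 2" for C :: real by simp
  obtain V where V: "open V" "A \<subseteq> V" "m V < outer_content m A + e / 2"
    by (rule outer_content_less[OF e])
  obtain W where W: "open W" "B \<subseteq> W" "m W < outer_content m B + e / 2"
    by (rule outer_content_less[OF e])
  have "outer_content m (A \<union> B) \<le> m (V \<union> W)" "outer_content m (A \<inter> B) \<le> m (V \<inter> W)"
    using V W by (auto intro!: outer_content_le[OF m])
  moreover have "m (V \<union> W) + m (V \<inter> W) = m V + m W" using m by (simp add: invariant_mean_def)
  ultimately show "outer_content m (A \<union> B) + outer_content m (A \<inter> B)
      \<le> outer_content m A + outer_content m B + e"
    using V W by linarith
qed

text \<open>Disjoint closed sets have disjoint open neighbourhoods, which split every open superset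
  of the union into two admissible parts.\<close>

lemma outer_content_disjoint:
  fixes A B :: "'a::metric_space set"
  assumes m: "invariant_mean Z S m" and AB: "closed A" "closed B" "A \<inter> B = {}"
  shows "outer_content m A + outer_content m B \<le> outer_content m (A \<union> B)"
proof (rule outer_content_ge)
  fix V assume V: "open V" "A \<union> B \<subseteq> V"
  obtain U W where UW: "open U" "open W" "A \<subseteq> U" "B \<subseteq> W" "U \<inter> W = {}"
    using t4_space[OF AB] by blast
  have "outer_content m A \<le> m (V \<inter> U)" "outer_content m B \<le> m (V \<inter> W)"
    using V UW by (auto intro!: outer_content_le[OF m])
  moreover have "m ((V \<inter> U) \<union> (V \<inter> W)) + m ((V \<inter> U) \<inter> (V \<inter> W)) = m (V \<inter> U) + m (V \<inter> W)"
    using m by (simp add: invariant_mean_def)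
  moreover have "(V \<inter> U) \<inter> (V \<inter> W) = {}" using UW(5) by auto
  moreover have "m {} = 0" "m ((V \<inter> U) \<union> (V \<inter> W)) \<le> m V" using m by (auto simp: invariant_mean_def)
  ultimately show "outer_content m A + outer_content m B \<le> m V" by simp
qed

text \<open>\<open>S\<close> and its inverse carry relatively open subsets of \<open>Z\<close> to
  relatively open ones. Extending these to open sets of the whole type leaves the mean unchanged,
  since only the part in \<open>Z\<close> counts.\<close>

lemma outer_content_invariant:
  fixes Z :: "'a::metric_space set"
  assumes m: "invariant_mean Z S m" and Z: "dynamical_system Z S" and C: "C \<subseteq> Z"
  shows "outer_content m {z \<in> Z. S z \<in> C} = outer_content m C"
proof (rule antisym)
  have inv: "m (S -` A) = m A" and int: "m (A \<inter> Z) = m A" for A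
    using m by (auto simp: invariant_mean_def)
  note Z' = dynamical_systemD[OF Z]
  show "outer_content m {z \<in> Z. S z \<in> C} \<le> outer_content m C"
  proof (rule outer_content_ge)
    fix V assume V: "open V" "C \<subseteq> V"
    then obtain V' where V': "open V'" "V' \<inter> Z = S -` V \<inter> Z"
      using Z'(2) by (auto simp: continuous_on_open_invariant)
    then have "outer_content m {z \<in> Z. S z \<in> C} \<le> m V'"
      using V(2) by (intro outer_content_le[OF m]) auto
    also have "m V' = m V" using int[of V'] int[of "S -` V"] V'(2) inv by simp
    finally show "outer_content m {z \<in> Z. S z \<in> C} \<le> m V" .
  qed
  show "outer_content m C \<le> outer_content m {z \<in> Z. S z \<in> C}"
  proof (rule outer_content_ge)
    fix V assume V: "open V" "{z \<in> Z. S z \<in> C} \<subseteq> V"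
    have "openin (top_of_set Z) ((S ^^ 1) ` (Z \<inter> V))"
      using V(1) by (intro open_image_homeomorphism[OF Z]) (simp add: openin_open_Int)
    then obtain V' where V': "open V'" "S ` (Z \<inter> V) = Z \<inter> V'" by (auto simp: openin_open)
    have "C \<subseteq> V'"
    proof
      fix c assume c: "c \<in> C"
      then obtain z where "z \<in> Z" "c = S z" using Z'(3) C by (auto simp: bij_betw_def)
      then have "c \<in> S ` (Z \<inter> V)" using V(2) c by auto
      then show "c \<in> V'" using V'(2) by simp
    qed
    then have "outer_content m C \<le> m V'" using V'(1) by (intro outer_content_le[OF m])
    also have "m V' = m (S -` V')" by (simp add: inv)
    also have "\<dots> = m (S -` V' \<inter> Z)" by (simp add: int)
    also have "S -` V' \<inter> Z = V \<inter> Z"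
    proof -
      have "S z \<in> V' \<longleftrightarrow> z \<in> V" if z: "z \<in> Z" for z
      proof -
        have "S z \<in> V' \<longleftrightarrow> S z \<in> S ` (Z \<inter> V)" using V'(2) Z'(3) z by (auto simp: bij_betw_def)
        also have "\<dots> \<longleftrightarrow> z \<in> V" using Z'(3) z by (auto simp: bij_betw_def inj_on_def)
        finally show ?thesis .
      qed
      then show ?thesis by auto
    qed
    also have "m (V \<inter> Z) = m V" by (rule int)
    finally show "outer_content m C \<le> m V" .
  qed
qed

text \<open>By minimality finitely many preimages of \<open>V\<close> cover \<open>Z\<close>, and
  all have mean \<open>m V\<close>, so \<open>1 \<le> real (Suc M) * m V\<close>. Every open
  superset of \<open>C\<close> has mean at least \<open>m V\<close>.\<close>

lemma outer_content_pos:
  fixes Z :: "'a::metric_space set"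
  assumes m: "invariant_mean Z S m" and Z: "minimal_system Z S"
    and V: "open V" "V \<inter> Z \<noteq> {}" "V \<inter> Z \<subseteq> C"
  shows "0 < outer_content m C"
proof -
  have inv: "m (S -` A) = m A" and int: "m (A \<inter> Z) = m A"
    and mono: "A \<subseteq> B \<Longrightarrow> m A \<le> m B" and m0: "m {} = 0" and m1: "m Z = 1" and nn: "0 \<le> m A"
    and md: "m (A \<union> B) + m (A \<inter> B) = m A + m B" for A B
    using m by (auto simp: invariant_mean_def)
  obtain M where M: "\<forall>z\<in>Z. \<exists>k\<le>M. (S ^^ k) z \<in> V" using minimal_return[OF Z V(1,2)] ..
  have invk: "m ((S ^^ k) -` V) = m V" for k
  proof (induction k)
    case (Suc k)
    have "(S ^^ Suc k) -` V = S -` ((S ^^ k) -` V)" by (auto simp: funpow_swap1)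
    also have "m \<dots> = m V" using Suc inv by simp
    finally show ?case .
  qed simp
  have subadd: "m (A \<union> B) \<le> m A + m B" for A B using md[of A B] nn[of "A \<inter> B"] by linarith
  have sub: "m (\<Union>k\<le>j. (S ^^ k) -` V) \<le> real (Suc j) * m V" for j
  proof (induction j)
    case 0
    have "(\<Union>k\<le>0::nat. (S ^^ k) -` V) = V" by auto
    then show ?case by simp
  next
    case (Suc j)
    have e: "(\<Union>k\<le>Suc j. (S ^^ k) -` V) = (\<Union>k\<le>j. (S ^^ k) -` V) \<union> (S ^^ Suc j) -` V"
      by (auto simp: atMost_Suc)
    have "m (\<Union>k\<le>Suc j. (S ^^ k) -` V) \<le> m (\<Union>k\<le>j. (S ^^ k) -` V) + m V"
      unfolding e invk[of "Suc j", symmetric] by (rule subadd)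
    also have "\<dots> \<le> real (Suc j) * m V + m V" using Suc by simp
    finally show ?case by (simp add: algebra_simps)
  qed
  have "Z \<subseteq> (\<Union>k\<le>M. (S ^^ k) -` V)" using M by blast
  then have "1 \<le> real (Suc M) * m V" using mono[of Z] sub[of M] m1 by (metis order_trans)
  then have "m V \<noteq> 0" by auto
  then have "0 < m V" using nn[of V] by simp
  also have "m V \<le> outer_content m C"
  proof (rule outer_content_ge)
    fix W assume "open W" "C \<subseteq> W"
    then have "m (V \<inter> Z) \<le> m W" using V(3) by (intro mono) auto
    then show "m V \<le> m W" by (simp add: int)
  qed
  finally show ?thesis .
qed

section \<open>Relative ergodicity over the maximal equicontinuous factors\<close>

text \<open>Kuratowski embedding: sending \<open>x\<close> to the function \<open>d x\<close> turns
  \<open>d\<close> into a sup distance, so the image is a factor on which the dynamics is isometric.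
  This equicontinuous factor is a function of the maximal one, hence \<open>d\<close> vanishes on
  the fibres of \<open>p\<close>.\<close>

lemma invariant_pseudometric_factors:
  fixes X :: "'a::metric_space set" and E :: "'e::metric_space set"
  assumes X: "dynamical_system X T" and mef: "max_equicontinuous_factor X T E R p"
    and d0: "\<And>x. x \<in> X \<Longrightarrow> d x x = 0"
    and dsym: "\<And>x y. x \<in> X \<Longrightarrow> y \<in> X \<Longrightarrow> d x y = d y x"
    and dtri: "\<And>x y z. x \<in> X \<Longrightarrow> y \<in> X \<Longrightarrow> z \<in> X \<Longrightarrow> d x z \<le> d x y + d y z"
    and dbd: "\<And>x y. x \<in> X \<Longrightarrow> y \<in> X \<Longrightarrow> d x y \<le> (B :: real)"
    and dinv: "\<And>x y. x \<in> X \<Longrightarrow> y \<in> X \<Longrightarrow> d (T x) (T y) = d x y"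
    and dcont: "\<And>x e. x \<in> X \<Longrightarrow> e > 0 \<Longrightarrow> \<exists>\<delta>>0. \<forall>y\<in>X. dist x y < \<delta> \<longrightarrow> d x y < e"
    and xy: "x \<in> X" "y \<in> X" "p x = p y"
  shows "d x y = 0"
proof -
  \<comment> \<open>On a discrete domain every bounded function is continuous, so \<open>f x\<close>
    belongs to the metric type of bounded continuous functions. Off \<open>X\<close> it takes the
    default value 0.\<close>
  define f where "f x u = (if of_discrete u \<in> X then d x (of_discrete u) else 0)"
    for x and u :: "'a discrete"
  define P where "P x = Bcontfun (f x)" for x
  have nn: "0 \<le> d x y" if "x \<in> X" "y \<in> X" for x y
    using dtri[of x y x] d0[of x] dsym[of x y] that by simp
  have Pf: "apply_bcontfun (P x) = f x" if "x \<in> X" for x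
  proof -
    have "f x u \<in> {0..max B 0}" for u
      using nn[OF that] dbd[OF that] by (auto simp: f_def intro: max.coboundedI1)
    then have "range (f x) \<subseteq> {0..max B 0}" by blast
    then have "bounded (range (f x))" using bounded_subset bounded_closed_interval by blast
    moreover have "continuous_on UNIV (f x)"
      by (simp add: continuous_on_open_vimage open_discrete)
    ultimately show ?thesis
      unfolding P_def by (intro Bcontfun_inverse) (simp add: bcontfun_def)
  qed
  have dP: "dist (P x) (P y) = d x y" if xy: "x \<in> X" "y \<in> X" for x y
  proof (rule antisym)
    show "dist (P x) (P y) \<le> d x y"
    proof (rule dist_bound)
      fix u :: "'a discrete"
      have "\<bar>d x v - d y v\<bar> \<le> d x y" if v: "v \<in> X" for v
        using dtri[of x y v] dtri[of y x v] dsym[of x y] xy v by auto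
      then show "dist (P x u) (P y u) \<le> d x y"
        using nn[OF xy] xy by (simp add: Pf f_def dist_real_def)
    qed
    \<comment> \<open>The sup distance is at least the difference at the point \<open>y\<close>,
      where \<open>d y y = 0\<close>.\<close>
    show "d x y \<le> dist (P x) (P y)"
      using dist_bounded[of "P x" "discrete y" "P y"] xy d0 nn
      by (simp add: Pf f_def dist_real_def discrete_inverse)
  qed
  have cP: "continuous_on X P"
    unfolding continuous_on_iff
  proof (intro ballI allI impI)
    fix x and e :: real assume x: "x \<in> X" and e: "0 < e"
    then obtain \<delta> where \<delta>: "\<delta> > 0" "\<forall>y\<in>X. dist x y < \<delta> \<longrightarrow> d x y < e" using dcont by blast
    show "\<exists>\<delta>>0. \<forall>y\<in>X. dist y x < \<delta> \<longrightarrow> dist (P y) (P x) < e"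
    proof (intro exI[of _ \<delta>] conjI ballI impI)
      fix y assume y: "y \<in> X" "dist y x < \<delta>"
      then have "d x y < e" using \<delta>(2) by (metis dist_commute)
      then show "dist (P y) (P x) < e" using dP[OF y(1) x] dsym[OF x y(1)] by simp
    qed (rule \<delta>(1))
  qed
  have TX: "T x \<in> X" if "x \<in> X" for x
    using dynamical_systemD(3)[OF X] that by (auto simp: bij_betw_def)
  have "P (T x) = P (T y) \<longleftrightarrow> P x = P y" if "x \<in> X" "y \<in> X" for x y
    using dP[of "T x" "T y"] dP[of x y] dinv that TX by (metis dist_eq_0_iff)
  then obtain Q where Q: "dynamical_system (P ` X) Q" "factor_map X T (P ` X) Q P"
    using quotient_system[OF X cP] by metis
  have dz: "d (zpow X T n x) (zpow X T n y) = d x y" if xy: "x \<in> X" "y \<in> X" for n x y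
  proof (induction n rule: int_induct[where k = 0])
    case base
    then show ?case by simp
  next
    case (step1 i)
    then show ?case
      using dinv zpow_closed[OF X] xy by (simp add: zpow_Suc[OF X])
  next
    case (step2 i)
    have "zpow X T i u = T (zpow X T (i - 1) u)" if "u \<in> X" for u
      using zpow_Suc[OF X that, of "i - 1"] by simp
    then show ?case
      using step2 dinv zpow_closed[OF X] xy by simp
  qed
  have "equicontinuous_system (P ` X) Q"
    unfolding equicontinuous_system_def
  proof (intro conjI allI impI Q(1))
    fix e :: real assume "e > 0"
    have "dist (zpow (P ` X) Q n (P x)) (zpow (P ` X) Q n (P y)) = dist (P x) (P y)"
      if "x \<in> X" "y \<in> X" for x y n
      using that factor_map_zpow[OF X Q(1) Q(2)] dP dz zpow_closed[OF X] by metis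
    then show "\<exists>\<delta>>0. \<forall>a\<in>P ` X. \<forall>b\<in>P ` X. dist a b < \<delta> \<longrightarrow>
        (\<forall>n. dist (zpow (P ` X) Q n a) (zpow (P ` X) Q n b) < e)"
      using \<open>e > 0\<close> by (intro exI[of _ e]) auto
  qed
  \<comment> \<open>The factor lives in a type of bounded functions rather than in
    \<open>nat \<Rightarrow> real\<close>, which calls for the universal property over arbitrary
    metric spaces.\<close>
  from max_equicontinuous_factor_universal[OF mef this Q(2)]
  obtain h where "\<forall>x\<in>X. P x = h (p x)" by blast
  then have "P x = P y" using xy by simp
  then show ?thesis using dP[of x y] xy by simp
qed

text \<open>The pseudometric \<open>d x y = \<mu> (N\<^sub>x \<union> N\<^sub>y) - \<mu> (N\<^sub>x)\<close> built from the content \<open>\<mu>\<close> of the sections of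
  \<open>N\<close> is continuous because \<open>x \<mapsto> \<mu> (N\<^sub>x)\<close> is upper semicontinuous and invariant, hence constant
  (McMahon).\<close>

lemma invariant_closed_saturated:
  fixes X :: "'a::metric_space set" and Z :: "'c::metric_space set" and E :: "'e::metric_space set"
  assumes X: "minimal_system X T" and Z: "minimal_system Z S"
    and mef: "max_equicontinuous_factor X T E R p"
    and N: "closed N" "N \<subseteq> X \<times> Z" "map_prod T S ` N = N"
    and x: "x \<in> X" "x' \<in> X" "p x = p x'"
    and V: "open V" "z \<in> V" "z \<in> Z" "\<And>z'. z' \<in> V \<Longrightarrow> z' \<in> Z \<Longrightarrow> (x, z') \<in> N"
  shows "(x', z) \<in> N"
proof (rule ccontr)
  assume notin: "(x', z) \<notin> N"
  have dX: "dynamical_system X T" and dZ: "dynamical_system Z S"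
    using X Z by (auto simp: minimal_system_def)
  note X' = dynamical_systemD[OF dX] and Z' = dynamical_systemD[OF dZ]
  have TX: "T u \<in> X" if "u \<in> X" for u using X'(3) that by (auto simp: bij_betw_def)
  have SZ: "S u \<in> Z" if "u \<in> Z" for u using Z'(3) that by (auto simp: bij_betw_def)
  have "S ` Z \<subseteq> Z" using SZ by auto
  then obtain m where m: "invariant_mean Z S m" by (rule invariant_mean_exists[OF V(3)])
  define s where "s u = {z. (u, z) \<in> N}" for u
  define c where "c A = outer_content m A" for A
  have sZ: "s u \<subseteq> Z" for u using N(2) by (auto simp: s_def)
  have cs: "closed (s u)" for u
  proof -
    have "continuous_on UNIV (\<lambda>z. (u, z))" by (intro continuous_intros)
    from continuous_closed_vimage[OF N(1), of "\<lambda>z. (u, z)"] show ?thesis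
      by (simp add: s_def vimage_def)
  qed
  have bij: "bij_betw (map_prod T S) (X \<times> Z) (X \<times> Z)"
    using X'(3) Z'(3) by (rule bij_betw_map_prod)
  have Ninv: "(T u, S w) \<in> N \<longleftrightarrow> (u, w) \<in> N" if "u \<in> X" "w \<in> Z" for u w
    using image_eq_iff_invariant[OF bij N(2)] N(3) that by auto
  \<comment> \<open>Sections over \<open>T u\<close> and \<open>T v\<close> pull back under
    \<open>S\<close> to those over \<open>u\<close> and \<open>v\<close>; the case
    \<open>u = v\<close> handles single sections.\<close>
  have sT: "s u \<union> s v = {w \<in> Z. S w \<in> s (T u) \<union> s (T v)}" if "u \<in> X" "v \<in> X" for u v
    using Ninv that sZ[of u] sZ[of v] by (auto simp: s_def)
  have cT: "c (s (T u) \<union> s (T v)) = c (s u \<union> s v)" if "u \<in> X" "v \<in> X" for u v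
    unfolding c_def sT[OF that]
    by (rule outer_content_invariant[OF m dZ, symmetric]) (use sZ in auto)
  have cpN: "compact N"
    by (rule compact_subset_closed[OF N(1,2) compact_Times[OF X'(1) Z'(1)]])
  \<comment> \<open>Upper semicontinuity of sections: the part of \<open>N\<close> outside
    \<open>W\<close> is compact, so its projection is closed and misses a ball about
    \<open>u\<close>.\<close>
  have usc: "\<exists>\<delta>>0. \<forall>v\<in>X. dist u v < \<delta> \<longrightarrow> s v \<subseteq> W" if W: "open W" "s u \<subseteq> W" for u W
  proof -
    have "closed (snd -` (- W) :: ('a \<times> 'c) set)"
      using W(1) by (intro closed_vimage_snd) auto
    then have "compact (N \<inter> snd -` (- W))" using cpN by (rule compact_Int_closed[rotated])
    then have "compact (fst ` (N \<inter> snd -` (- W)))"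
      by (intro compact_continuous_image continuous_on_fst continuous_on_id)
    then have "open (- fst ` (N \<inter> snd -` (- W)))" by (simp add: compact_imp_closed open_Compl)
    moreover have "u \<in> - fst ` (N \<inter> snd -` (- W))" using W(2) by (auto simp: s_def)
    ultimately obtain \<delta> where \<delta>: "\<delta> > 0" "ball u \<delta> \<subseteq> - fst ` (N \<inter> snd -` (- W))"
      by (rule openE)
    have "s v \<subseteq> W" if "dist u v < \<delta>" for v
    proof
      fix w assume w: "w \<in> s v"
      have "v \<in> ball u \<delta>" using that by simp
      then have "v \<notin> fst ` (N \<inter> snd -` (- W))" using \<delta>(2) by blast
      then show "w \<in> W" using w by (force simp: s_def)
    qed
    then show ?thesis using \<delta>(1) by blast
  qed
  have c_le: "c A \<le> m W" if "open W" "A \<subseteq> W" for A W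
    unfolding c_def using outer_content_le[OF m that] .
  have c_mono: "c A \<le> c B" if "A \<subseteq> B" for A B
    unfolding c_def using outer_content_mono[OF m that] .
  \<comment> \<open>By minimality the orbit of \<open>v\<close> comes so close to \<open>u\<close>
    that its section lies in \<open>W\<close>, while invariance keeps the content equal to that of
    \<open>s v\<close>.\<close>
  have c_const_le: "c (s v) \<le> c (s u)" if uv: "u \<in> X" "v \<in> X" for u v
  proof (rule ccontr)
    assume "\<not> ?thesis"
    then have "outer_content m (s u) < c (s v)" by (simp add: c_def)
    then obtain W where W: "open W" "s u \<subseteq> W" "m W < c (s v)" by (rule outer_content_less)
    obtain \<delta> where \<delta>: "\<delta> > 0" "\<forall>v\<in>X. dist u v < \<delta> \<longrightarrow> s v \<subseteq> W" using usc[OF W(1,2)] by blast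
    have "u \<in> ball u \<delta>" using \<delta>(1) by simp
    then have "ball u \<delta> \<inter> X \<noteq> {}" using uv(1) by blast
    from minimal_return[OF X open_ball this] obtain M
      where "\<forall>x\<in>X. \<exists>k\<le>M. (T ^^ k) x \<in> ball u \<delta>" ..
    then obtain k where k: "(T ^^ k) v \<in> ball u \<delta>" using uv(2) by blast
    have "c (s ((T ^^ k) v)) = c (s v)"
    proof (induction k)
      case (Suc k)
      then show ?case using cT[of "(T ^^ k) v" "(T ^^ k) v"] funpow_closed[OF dX uv(2)] by simp
    qed simp
    moreover have "c (s ((T ^^ k) v)) \<le> m W"
      using k \<delta>(2) funpow_closed[OF dX uv(2)] by (intro c_le[OF W(1)]) auto
    ultimately show False using W(3) by simp
  qed
  then have c_const: "c (s v) = c (s u)" if "u \<in> X" "v \<in> X" for u v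
    using that by (simp add: antisym)
  define d where "d u v = c (s u \<union> s v) - c (s u)" for u v
  have "d x' x = 0"
  proof (rule invariant_pseudometric_factors[OF dX mef])
    show "d u u = 0" for u by (simp add: d_def)
    show "d u v = d v u" if "u \<in> X" "v \<in> X" for u v
      using c_const[OF that] by (simp add: d_def Un_commute)
    \<comment> \<open>Submodularity for \<open>s u \<union> s v\<close> and
      \<open>s v \<union> s w\<close>, whose intersection contains \<open>s v\<close>.\<close>
    show "d u w \<le> d u v + d v w" if uvw: "u \<in> X" "v \<in> X" "w \<in> X" for u v w
    proof -
      have "c ((s u \<union> s v) \<union> (s v \<union> s w)) + c ((s u \<union> s v) \<inter> (s v \<union> s w))
          \<le> c (s u \<union> s v) + c (s v \<union> s w)"
        unfolding c_def by (rule outer_content_submodular[OF m])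
      moreover have "c (s u \<union> s w) \<le> c ((s u \<union> s v) \<union> (s v \<union> s w))"
        "c (s v) \<le> c ((s u \<union> s v) \<inter> (s v \<union> s w))" by (auto intro!: c_mono)
      ultimately show ?thesis using c_const[OF uvw(1,2)] unfolding d_def by linarith
    qed
    show "d u v \<le> m UNIV" for u v
    proof -
      have "0 \<le> c (s u)"
        unfolding c_def by (rule outer_content_ge) (use m in \<open>simp add: invariant_mean_def\<close>)
      moreover have "c (s u \<union> s v) \<le> m UNIV" by (rule c_le) auto
      ultimately show ?thesis by (simp add: d_def)
    qed
    show "d (T u) (T v) = d u v" if "u \<in> X" "v \<in> X" for u v
      using cT[OF that] c_const[OF that(1) TX[OF that(1)]] unfolding d_def by linarith
    \<comment> \<open>For \<open>v\<close> near \<open>u\<close> both sections lie in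
      \<open>W\<close>, whose mean exceeds \<open>c (s u)\<close> by less than
      \<open>e\<close>.\<close>
    show "\<exists>\<delta>>0. \<forall>v\<in>X. dist u v < \<delta> \<longrightarrow> d u v < e" if "u \<in> X" and e: "e > 0" for u e
    proof -
      have "outer_content m (s u) < c (s u) + e" using e by (simp add: c_def)
      then obtain W where W: "open W" "s u \<subseteq> W" "m W < c (s u) + e" by (rule outer_content_less)
      obtain \<delta> where \<delta>: "\<delta> > 0" "\<forall>v\<in>X. dist u v < \<delta> \<longrightarrow> s v \<subseteq> W" using usc[OF W(1,2)] by blast
      have "d u v < e" if "v \<in> X" "dist u v < \<delta>" for v
        using c_le[OF W(1), of "s u \<union> s v"] \<delta>(2) that W by (auto simp: d_def)
      then show ?thesis using \<delta>(1) by blast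
    qed
    show "x' \<in> X" "x \<in> X" "p x' = p x" using x by auto
  qed
  then have eq: "c (s x' \<union> s x) = c (s x')" by (simp add: d_def)
  have "open (V \<inter> - s x')" "z \<in> V \<inter> - s x'"
    using V(1,2) cs[of x'] notin by (auto simp: s_def open_Compl)
  then obtain r where r: "r > 0" "cball z r \<subseteq> V \<inter> - s x'"
    by (meson open_contains_cball)
  \<comment> \<open>A closed piece of \<open>s x\<close> with interior in \<open>Z\<close> and
    disjoint from \<open>s x'\<close>; its positive content contradicts
    \<open>d x' x = 0\<close>.\<close>
  define D where "D = cball z r \<inter> Z"
  have D: "closed D" "s x' \<inter> D = {}" "D \<subseteq> s x"
    using r(2) V(4) compact_imp_closed[OF Z'(1)] by (auto simp: D_def s_def)
  have "z \<in> ball z r" using r(1) by simp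
  then have "ball z r \<inter> Z \<noteq> {}" using V(3) by blast
  then have "0 < c D"
    unfolding c_def by (rule outer_content_pos[OF m Z open_ball]) (auto simp: D_def)
  moreover have "c (s x') + c D \<le> c (s x' \<union> D)"
    unfolding c_def by (rule outer_content_disjoint[OF m cs D(1,2)])
  moreover have "c (s x' \<union> D) \<le> c (s x' \<union> s x)" using D(3) by (intro c_mono) auto
  ultimately show False using eq by simp
qed

section \<open>From saturation in one coordinate to saturation in both\<close>

lemma product_system:
  assumes X: "dynamical_system X T" and Z: "dynamical_system Z S"
  shows "dynamical_system (X \<times> Z) (map_prod T S)"
proof (rule dynamical_systemI)
  note X' = dynamical_systemD[OF X] and Z' = dynamical_systemD[OF Z]
  show "compact (X \<times> Z)" using X'(1) Z'(1) by (rule compact_Times)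
  show "bij_betw (map_prod T S) (X \<times> Z) (X \<times> Z)" using X'(3) Z'(3) by (rule bij_betw_map_prod)
  have "continuous_on (X \<times> Z) (\<lambda>w. T (fst w))"
    by (rule continuous_on_compose2[OF X'(2)]) (auto intro: continuous_intros)
  moreover have "continuous_on (X \<times> Z) (\<lambda>w. S (snd w))"
    by (rule continuous_on_compose2[OF Z'(2)]) (auto intro: continuous_intros)
  ultimately have "continuous_on (X \<times> Z) (\<lambda>w. (T (fst w), S (snd w)))"
    by (rule continuous_on_Pair)
  then show "continuous_on (X \<times> Z) (map_prod T S)"
    by (simp add: map_prod_def case_prod_beta')
qed

text \<open>Images and preimages of the relative interior are relatively open subsets of
  \<open>N\<close>, so \<open>f\<close> maps the interior onto itself; compactness carries this over
  to the closure.\<close>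

lemma closure_interior_invariant:
  fixes W :: "'a::metric_space set"
  assumes W: "dynamical_system W f" and N: "closed N" "N \<subseteq> W" "f ` N = N"
  shows "f ` closure (top_of_set W interior_of N) = closure (top_of_set W interior_of N)"
proof -
  define V where "V = top_of_set W interior_of N"
  note W' = dynamical_systemD[OF W]
  have VN: "V \<subseteq> N" unfolding V_def by (rule interior_of_subset)
  then have VW: "V \<subseteq> W" using N(2) by blast
  have clN: "closure V \<subseteq> N" using VN N(1) by (rule closure_minimal)
  have cf: "continuous_on (closure V) f"
    using W'(2) clN N(2) by (meson continuous_on_subset order_trans)
  have oV: "openin (top_of_set W) V" by (simp add: V_def)
  have "openin (top_of_set W) ((f ^^ 1) ` V)" by (rule open_image_homeomorphism[OF W oV])
  then have "openin (top_of_set W) (f ` V)" by simp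
  moreover have "f ` V \<subseteq> N" using VN N(3) by blast
  ultimately have fwd: "f ` V \<subseteq> V" unfolding V_def by (rule interior_of_maximal[rotated])
  have "openin (top_of_set W) (W \<inter> f -` V)"
    using W'(2,3) oV by (intro continuous_openin_preimage[OF W'(2)]) (auto simp: bij_betw_def)
  moreover have "W \<inter> f -` V \<subseteq> N"
    using image_eq_iff_invariant[OF W'(3) N(2)] N(3) VN by blast
  ultimately have "W \<inter> f -` V \<subseteq> V" unfolding V_def by (rule interior_of_maximal[rotated])
  with fwd have "\<forall>w\<in>W. f w \<in> V \<longleftrightarrow> w \<in> V" by blast
  then have fV: "f ` V = V" using image_eq_iff_invariant[OF W'(3) VW] by blast
  have "f ` closure V \<subseteq> closure V"
    by (rule image_closure_subset[OF cf closed_closure]) (use fV closure_subset in auto)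
  moreover have "closure V \<subseteq> f ` closure V"
  proof (rule closure_minimal)
    show "V \<subseteq> f ` closure V" using fV closure_subset[of V] by blast
    have "compact (closure V)"
      by (rule compact_subset_closed[OF closed_closure order_trans[OF clN N(2)] W'(1)])
    then show "closed (f ` closure V)" using cf compact_continuous_image compact_imp_closed by blast
  qed
  ultimately show ?thesis unfolding V_def by blast
qed

text \<open>For continuous \<open>q\<close> on compact \<open>Z\<close> the fibres always vary upper
  semicontinuously. This is the complementary half, which may fail but holds at generic points
  (\<open>generic_point_lsc\<close>).\<close>

definition fibres_lsc_at :: "'a::metric_space set \<Rightarrow> ('a \<Rightarrow> 'b) \<Rightarrow> 'a \<Rightarrow> bool" where
  "fibres_lsc_at Z q z \<longleftrightarrow>
     (\<forall>z'\<in>Z. q z' = q z \<longrightarrow> (\<forall>e>0. \<exists>\<delta>>0. \<forall>y\<in>Z. dist z y < \<delta> \<longrightarrow>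
        (\<exists>y'\<in>Z. q y' = q y \<and> dist z' y' < e)))"

lemma dist_prod_le_add: "dist (a, b) (c, d) \<le> dist a c + dist b d"
  by (simp add: dist_Pair_Pair sqrt_sum_squares_le_sum)

text \<open>Two applications of \<open>invariant_closed_saturated\<close>. The first moves
  \<open>x\<close> to \<open>x'\<close> inside the closure \<open>M\<close> of the interior of
  \<open>N\<close>, so \<open>(x', z)\<close> is a limit of interior points \<open>(a, b)\<close>.
  Lower semicontinuity supplies \<open>b'\<close> near \<open>z'\<close> in the fibre of
  \<open>b\<close>, and the second application, with coordinates exchanged, puts
  \<open>(a, b')\<close> into \<open>N\<close>.\<close>

lemma relatively_ergodic:
  fixes X :: "'a::metric_space set" and Z :: "'c::metric_space set"
    and E :: "'e::metric_space set" and F :: "'f::metric_space set"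
  assumes X: "minimal_system X T" and Z: "minimal_system Z S"
    and mefX: "max_equicontinuous_factor X T E R p" and mefZ: "max_equicontinuous_factor Z S F Q q"
    and N: "closed N" "N \<subseteq> X \<times> Z" "map_prod T S ` N = N"
    and U: "open U" "(x, z) \<in> U" "U \<inter> (X \<times> Z) \<subseteq> N"
    and x: "x \<in> X" "x' \<in> X" "p x = p x'" and z: "z \<in> Z" "z' \<in> Z" "q z = q z'"
    and lsc: "fibres_lsc_at Z q z"
  shows "(x', z') \<in> N"
proof -
  have dX: "dynamical_system X T" and dZ: "dynamical_system Z S"
    using X Z by (auto simp: minimal_system_def)
  define V where "V = top_of_set (X \<times> Z) interior_of N"
  define M where "M = closure V"
  have VN: "V \<subseteq> N" unfolding V_def by (rule interior_of_subset)
  have MN: "M \<subseteq> N" unfolding M_def using VN N(1) by (rule closure_minimal)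
  have M: "closed M" "M \<subseteq> X \<times> Z" "map_prod T S ` M = M"
    using MN N(2) closure_interior_invariant[OF product_system[OF dX dZ] N]
    by (auto simp: M_def V_def)
  have oV: "openin (top_of_set (X \<times> Z)) V" by (simp add: V_def)
  then obtain V' where V': "open V'" "V = (X \<times> Z) \<inter> V'" by (auto simp: openin_open)
  have "openin (top_of_set (X \<times> Z)) (U \<inter> (X \<times> Z))"
    using U(1) by (auto simp: openin_open)
  then have UV: "U \<inter> (X \<times> Z) \<subseteq> V"
    unfolding V_def using U(3) by (rule interior_of_maximal[rotated])
  have "open (Pair x -` U)" using U(1) by (intro continuous_open_vimage continuous_intros)
  then have x'M: "(x', z) \<in> M"
  proof (rule invariant_closed_saturated[OF X Z mefX M x])
    show "z \<in> Pair x -` U" using U(2) by simp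
    show "z \<in> Z" by (rule z(1))
    show "(x, y) \<in> M" if "y \<in> Pair x -` U" "y \<in> Z" for y
    proof -
      have "(x, y) \<in> V" using that x(1) UV by blast
      then show ?thesis unfolding M_def using closure_subset by (rule subsetD[rotated])
    qed
  qed
  define N' where "N' = prod.swap ` N"
  have cpN: "compact N"
    by (rule compact_subset_closed[OF N(1,2) compact_Times[OF dynamical_systemD(1)[OF dX]
            dynamical_systemD(1)[OF dZ]]])
  have "compact N'"
    unfolding N'_def by (intro compact_continuous_image cpN continuous_on_swap)
  then have N': "closed N'" "N' \<subseteq> Z \<times> X"
    using N(2) by (auto simp: compact_imp_closed N'_def)
  have N'3: "map_prod S T ` N' = N'"
  proof -
    have "map_prod S T ` N' = prod.swap ` map_prod T S ` N"
      unfolding N'_def image_image by (rule image_cong) auto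
    then show ?thesis by (simp add: N(3) N'_def)
  qed
  have N'iff: "(b, a) \<in> N' \<longleftrightarrow> (a, b) \<in> N" for a b
    by (force simp: N'_def)
  have "\<exists>y\<in>N. dist y (x', z') < e" if "e > 0" for e
  proof -
    have e: "e / 2 > 0" using that by simp
    then obtain \<delta> where \<delta>: "\<delta> > 0"
      "\<forall>y\<in>Z. dist z y < \<delta> \<longrightarrow> (\<exists>y'\<in>Z. q y' = q y \<and> dist z' y' < e / 2)"
      using lsc z unfolding fibres_lsc_at_def by metis
    have "0 < min \<delta> (e / 2)" using \<delta>(1) e by simp
    then obtain w where w: "w \<in> V" "dist w (x', z) < min \<delta> (e / 2)"
      using x'M unfolding M_def closure_approachable by blast
    obtain a b where ab: "w = (a, b)" by force
    have abXZ: "a \<in> X" "b \<in> Z" using w(1) V'(2) ab by auto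
    have "dist b z < \<delta>" "dist a x' < e / 2"
      using w(2) dist_snd_le[of w "(x', z)"] dist_fst_le[of w "(x', z)"] by (auto simp: ab)
    then obtain b' where b': "b' \<in> Z" "q b' = q b" "dist z' b' < e / 2"
      using \<delta>(2) abXZ(2) by (metis dist_commute)
    \<comment> \<open>As \<open>(a, b)\<close> is interior, the slice of \<open>N\<close> at height
      \<open>b\<close> contains a neighbourhood of \<open>a\<close>, as the second application
      requires.\<close>
    have "open ((\<lambda>u. (u, b)) -` V')"
      using V'(1) by (intro continuous_open_vimage continuous_intros)
    then have "(b', a) \<in> N'"
    proof (rule invariant_closed_saturated[OF Z X mefZ N' N'3 abXZ(2) b'(1) b'(2)[symmetric]])
      show "a \<in> (\<lambda>u. (u, b)) -` V'" using w(1) V'(2) ab by simp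
      show "a \<in> X" by (rule abXZ(1))
      show "(b, u) \<in> N'" if "u \<in> (\<lambda>u. (u, b)) -` V'" "u \<in> X" for u
        unfolding N'iff using that V'(2) abXZ VN by blast
    qed
    then have "(a, b') \<in> N" by (simp add: N'iff)
    moreover have "dist (a, b') (x', z') < e"
      using dist_prod_le_add[of a b' x' z'] b'(3) \<open>dist a x' < e / 2\<close> by (simp add: dist_commute)
    ultimately show ?thesis by blast
  qed
  then have "(x', z') \<in> closure N" unfolding closure_approachable by blast
  then show ?thesis using N(1) by simp
qed

section \<open>Generic points by Baire category\<close>

lemma Baire_generic_point:
  fixes K :: "'a::metric_space set"
  assumes K: "compact K" and L: "countable \<L>" "\<And>L. L \<in> \<L> \<Longrightarrow> closed L"
    and U: "open U" "U \<inter> K \<noteq> {}"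
  obtains w where "w \<in> U" "w \<in> K"
    "\<And>L. L \<in> \<L> \<Longrightarrow> w \<in> L \<Longrightarrow> \<exists>V. open V \<and> w \<in> V \<and> V \<inter> K \<subseteq> L"
proof -
  define I where "I L = top_of_set K interior_of (K \<inter> L)" for L
  \<comment> \<open>The points of \<open>L\<close> in \<open>K\<close> at which \<open>L\<close> is
    not a neighbourhood relative to \<open>K\<close> form a closed set without interior. A point
    outside all these sets is generic for the whole countable family.\<close>
  define B where "B L = (K \<inter> L) - I L" for L
  have IL: "I L \<subseteq> K \<inter> L" and oI: "openin (top_of_set K) (I L)" for L
    by (auto simp: I_def dest: subsetD[OF interior_of_subset])
  have "closedin (top_of_set K) (B L)" if "L \<in> \<L>" for L
    unfolding B_def using L(2)[OF that] oI by (intro closedin_diff) (auto simp: closedin_closed)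
  moreover have "top_of_set K interior_of (B L) = {}" for L
  proof -
    have o: "openin (top_of_set K) (top_of_set K interior_of (B L))" by simp
    have s: "top_of_set K interior_of (B L) \<subseteq> B L" by (rule interior_of_subset)
    have "top_of_set K interior_of (B L) \<subseteq> I L"
      unfolding I_def using s o by (intro interior_of_maximal) (auto simp: B_def)
    then show ?thesis using s by (auto simp: B_def)
  qed
  moreover have "locally_compact_space (top_of_set K)" "regular_space (top_of_set K)"
    using K by (auto simp: compact_imp_locally_compact_space compact_space_subtopology
        metrizable_imp_regular_space metrizable_space_subtopology metrizable_space_euclidean)
  ultimately have "top_of_set K interior_of \<Union>(B ` \<L>) = {}"
    using L(1) by (intro Baire_category_alt) auto
  moreover have "openin (top_of_set K) (U \<inter> K)" using U(1) by (auto simp: openin_open)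
  ultimately have "\<not> U \<inter> K \<subseteq> \<Union>(B ` \<L>)"
    using U(2) interior_of_maximal[of "U \<inter> K" "\<Union>(B ` \<L>)" "top_of_set K"] by auto
  then obtain w where w: "w \<in> U" "w \<in> K" "w \<notin> \<Union>(B ` \<L>)" by blast
  show thesis
  proof (rule that[OF w(1,2)])
    fix L assume "L \<in> \<L>" "w \<in> L"
    then have "w \<in> I L" using w by (auto simp: B_def)
    moreover obtain V where "open V" "I L = K \<inter> V" using oI[of L] by (auto simp: openin_open)
    ultimately show "\<exists>V. open V \<and> w \<in> V \<and> V \<inter> K \<subseteq> L" using IL[of L] by blast
  qed
qed

lemma compact_countable_closed_base:
  fixes Z :: "'a::metric_space set"
  assumes "compact Z"
  obtains \<C> where "countable \<C>" "\<And>C. C \<in> \<C> \<Longrightarrow> closed C"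
    "\<And>z e. z \<in> Z \<Longrightarrow> e > 0 \<Longrightarrow> \<exists>C\<in>\<C>. z \<in> C \<and> C \<subseteq> ball z e"
proof -
  have tb: "\<forall>\<epsilon>>0. \<exists>k. finite k \<and> Z \<subseteq> (\<Union>x\<in>k. ball x \<epsilon>)"
    using assms unfolding compact_eq_totally_bounded by (rule conjunct2)
  have "\<forall>i. \<exists>k. finite k \<and> Z \<subseteq> (\<Union>x\<in>k. ball x (1 / real (Suc i)))"
    by (intro allI tb[rule_format]) simp
  from choice[OF this] obtain k where
    k: "\<forall>i. finite (k i) \<and> Z \<subseteq> (\<Union>x\<in>k i. ball x (1 / real (Suc i)))" ..
  define \<C> where "\<C> = (\<Union>i. (\<lambda>x. cball x (1 / real (Suc i))) ` k i)"
  show thesis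
  proof (rule that)
    show "countable \<C>"
      unfolding \<C>_def using k by (intro countable_UN countable_image) (auto intro: countable_finite)
    show "closed C" if "C \<in> \<C>" for C using that by (auto simp: \<C>_def)
    show "\<exists>C\<in>\<C>. z \<in> C \<and> C \<subseteq> ball z e" if z: "z \<in> Z" "e > 0" for z e
    proof -
      have "e / 2 > 0" using z(2) by simp
      then obtain i where i: "1 / real (Suc i) < e / 2" by (rule nat_approx_posE)
      have "z \<in> (\<Union>x\<in>k i. ball x (1 / real (Suc i)))" using k z(1) by blast
      then obtain x where x: "x \<in> k i" "dist x z < 1 / real (Suc i)" by auto
      have "cball x (1 / real (Suc i)) \<subseteq> ball z e"
      proof
        fix y assume "y \<in> cball x (1 / real (Suc i))"
        then show "y \<in> ball z e"
          using dist_triangle[of z y x] x(2) i by (simp add: dist_commute)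
      qed
      moreover have "cball x (1 / real (Suc i)) \<in> \<C>" using x(1) by (auto simp: \<C>_def)
      ultimately show ?thesis using x(2) by (intro bexI[of _ "cball x (1 / real (Suc i))"]) auto
    qed
  qed
qed

text \<open>Baire's theorem is applied to the given family enlarged by the
  \<open>q\<close>-saturations \<open>D C\<close> of countably many small closed sets
  \<open>C\<close>. If \<open>C\<close> contains a point of the fibre of a generic \<open>z\<close>,
  then \<open>D C\<close> is a neighbourhood of \<open>z\<close>, so the fibres of nearby points
  also meet \<open>C\<close>.\<close>

lemma generic_point_lsc:
  fixes X :: "'a::metric_space set" and Z :: "'c::metric_space set" and q :: "'c \<Rightarrow> 'f::metric_space"
  assumes X: "compact X" and Z: "compact Z" and q: "continuous_on Z q"
    and L: "countable \<L>" "\<And>L. L \<in> \<L> \<Longrightarrow> closed L"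
    and U: "open U" "U \<inter> (X \<times> Z) \<noteq> {}"
  obtains x z where "(x, z) \<in> U" "x \<in> X" "z \<in> Z" "fibres_lsc_at Z q z"
    "\<And>L. L \<in> \<L> \<Longrightarrow> (x, z) \<in> L \<Longrightarrow> \<exists>V. open V \<and> (x, z) \<in> V \<and> V \<inter> (X \<times> Z) \<subseteq> L"
proof -
  obtain \<C> where \<C>: "countable \<C>" "\<And>C. C \<in> \<C> \<Longrightarrow> closed C"
    "\<And>z e. z \<in> Z \<Longrightarrow> e > 0 \<Longrightarrow> \<exists>C\<in>\<C>. z \<in> C \<and> C \<subseteq> ball z e"
    by (rule compact_countable_closed_base[OF Z]) (rule that)
  define D where "D C = Z \<inter> q -` (q ` (Z \<inter> C))" for C
  have cD: "closed (D C)" if "C \<in> \<C>" for C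
  proof -
    have "compact (Z \<inter> C)" using Z \<C>(2)[OF that] by (rule compact_Int_closed)
    then have "compact (q ` (Z \<inter> C))"
      using continuous_on_subset[OF q] by (intro compact_continuous_image) auto
    then have "closed (q -` (q ` (Z \<inter> C)) \<inter> Z)"
      using q Z by (intro closed_vimage_Int continuous_on_closed_vimage[THEN iffD1, rule_format]
          compact_imp_closed)
    then show ?thesis by (simp add: D_def Int_commute)
  qed
  have cnt: "countable (\<L> \<union> (\<lambda>C. X \<times> D C) ` \<C>)" using L(1) \<C>(1) by simp
  have cl: "closed L" if "L \<in> \<L> \<union> (\<lambda>C. X \<times> D C) ` \<C>" for L
    using that L(2) cD closed_Times[OF compact_imp_closed[OF X]] by auto
  obtain w where w: "w \<in> U" "w \<in> X \<times> Z"
    "\<And>L. L \<in> \<L> \<union> (\<lambda>C. X \<times> D C) ` \<C> \<Longrightarrow> w \<in> L \<Longrightarrow> \<exists>V. open V \<and> w \<in> V \<and> V \<inter> (X \<times> Z) \<subseteq> L"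
    by (rule Baire_generic_point[OF compact_Times[OF X Z] cnt cl U]) (assumption | rule that)+
  obtain x z where xz: "w = (x, z)" by force
  have "fibres_lsc_at Z q z"
    unfolding fibres_lsc_at_def
  proof (intro ballI impI allI)
    fix z' and e :: real assume z': "z' \<in> Z" "q z' = q z" and e: "0 < e"
    obtain C where C: "C \<in> \<C>" "z' \<in> C" "C \<subseteq> ball z' e" using \<C>(3)[OF z'(1) e] by blast
    have "q z \<in> q ` (Z \<inter> C)" using z' C(2) by (intro image_eqI[of _ _ z']) auto
    then have "(x, z) \<in> X \<times> D C" using w(2) by (simp add: xz D_def)
    then obtain V where V: "open V" "(x, z) \<in> V" "V \<inter> (X \<times> Z) \<subseteq> X \<times> D C"
      using w(3)[of "X \<times> D C"] C(1) by (auto simp: xz)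
    have "open (Pair x -` V)" using V(1) by (intro continuous_open_vimage continuous_intros)
    moreover have "z \<in> Pair x -` V" using V(2) by simp
    ultimately obtain \<delta> where \<delta>: "\<delta> > 0" "ball z \<delta> \<subseteq> Pair x -` V" by (rule openE)
    have "\<exists>y'\<in>Z. q y' = q y \<and> dist z' y' < e" if y: "y \<in> Z" "dist z y < \<delta>" for y
    proof -
      have "y \<in> ball z \<delta>" using y(2) by simp
      then have "(x, y) \<in> V" using \<delta>(2) by blast
      then have "y \<in> D C" using V(3) y(1) w(2) by (auto simp: xz)
      then obtain c where "c \<in> Z" "c \<in> C" "q c = q y" by (auto simp: D_def)
      then show ?thesis using C(3) by (intro bexI[of _ c]) auto
    qed
    then show "\<exists>\<delta>>0. \<forall>y\<in>Z. dist z y < \<delta> \<longrightarrow> (\<exists>y'\<in>Z. q y' = q y \<and> dist z' y' < e)"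
      using \<delta>(1) by blast
  qed
  moreover have "\<exists>V. open V \<and> (x, z) \<in> V \<and> V \<inter> (X \<times> Z) \<subseteq> L" if "L \<in> \<L>" "(x, z) \<in> L" for L
    using w(3)[of L] that by (simp add: xz)
  ultimately show thesis using w(1,2) by (intro that[of x z]) (auto simp: xz)
qed

section \<open>Invariant neighbourhoods of orbits\<close>

lemma zpow_pair_invariant:
  assumes X: "dynamical_system X T" and Z: "dynamical_system Z S"
    and N: "\<And>x z. x \<in> X \<Longrightarrow> z \<in> Z \<Longrightarrow> (T x, S z) \<in> N \<longleftrightarrow> (x, z) \<in> N"
    and xz: "x \<in> X" "z \<in> Z"
  shows "(zpow X T n x, zpow Z S n z) \<in> N \<longleftrightarrow> (x, z) \<in> N"
proof (induction n rule: int_induct[where k = 0])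
  case base
  then show ?case by simp
next
  case (step1 i)
  then show ?case
    using N[OF zpow_closed[OF X xz(1)] zpow_closed[OF Z xz(2)]]
    by (simp add: zpow_Suc[OF X xz(1)] zpow_Suc[OF Z xz(2)])
next
  case (step2 i)
  have "zpow X T i x = T (zpow X T (i - 1) x)" "zpow Z S i z = S (zpow Z S (i - 1) z)"
    using zpow_Suc[OF X xz(1), of "i - 1"] zpow_Suc[OF Z xz(2), of "i - 1"] by simp_all
  then show ?case
    using step2 N[OF zpow_closed[OF X xz(1)] zpow_closed[OF Z xz(2)], of "i - 1" "i - 1"] by simp
qed

text \<open>For equicontinuous systems this is a closed invariant neighbourhood of the orbit of \<open>(e, f)\<close>; the
  slack \<open>\<eta>\<close> makes it closed.\<close>

definition orbit_tube ::
  "'e::metric_space set \<Rightarrow> ('e \<Rightarrow> 'e) \<Rightarrow> 'e \<Rightarrow> 'f::metric_space set \<Rightarrow> ('f \<Rightarrow> 'f) \<Rightarrow> 'f \<Rightarrow> real \<Rightarrow> ('e \<times> 'f) set"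
  where "orbit_tube E R e F Q f r = {(u, v). u \<in> E \<and> v \<in> F \<and>
     (\<forall>\<eta>>0. \<exists>n. dist e (zpow E R n u) < r + \<eta> \<and> dist f (zpow F Q n v) < r + \<eta>)}"

lemma orbit_tube_invariant:
  assumes E: "dynamical_system E R" and F: "dynamical_system F Q" and uv: "u \<in> E" "v \<in> F"
  shows "(R u, Q v) \<in> orbit_tube E R e F Q f r \<longleftrightarrow> (u, v) \<in> orbit_tube E R e F Q f r"
proof -
  have RQ: "R u \<in> E" "Q v \<in> F"
    using dynamical_systemD(3)[OF E] dynamical_systemD(3)[OF F] uv by (auto simp: bij_betw_def)
  \<comment> \<open>Membership in the tube asks for some time; passing to the image point only
    shifts this time by one.\<close>
  have shift: "(\<exists>n. P (n + 1)) \<longleftrightarrow> (\<exists>n. P n)" for P :: "int \<Rightarrow> bool"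
    by (metis diff_add_cancel)
  show ?thesis
    unfolding orbit_tube_def using uv RQ
      shift[of "\<lambda>n. dist e (zpow E R n u) < r + _ \<and> dist f (zpow F Q n v) < r + _"]
    by (simp add: zpow_Suc_right[OF E] zpow_Suc_right[OF F])
qed

text \<open>Equicontinuity controls all times at once: a point of the tube near \<open>w\<close>
  meets the bounds with slack \<open>\<eta> / 2\<close> at some time \<open>n\<close>, and at the
  same \<open>n\<close> the orbit of \<open>w\<close> is less than another \<open>\<eta> / 2\<close>
  away.\<close>

lemma closed_orbit_tube:
  fixes E :: "'e::metric_space set" and F :: "'f::metric_space set"
  assumes E: "equicontinuous_system E R" and F: "equicontinuous_system F Q"
  shows "closed (orbit_tube E R e F Q f r)"
proof -
  have cl: "closed (E \<times> F)"
    using E F unfolding equicontinuous_system_def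
    by (intro closed_Times compact_imp_closed dynamical_systemD(1)) auto
  have "w \<in> orbit_tube E R e F Q f r" if w: "w \<in> closure (orbit_tube E R e F Q f r)" for w
  proof -
    obtain u v where uv: "w = (u, v)" by force
    have "orbit_tube E R e F Q f r \<subseteq> E \<times> F" by (auto simp: orbit_tube_def)
    then have "w \<in> E \<times> F" using w closure_minimal[OF _ cl] by blast
    then have uvEF: "u \<in> E" "v \<in> F" by (auto simp: uv)
    have "\<exists>n. dist e (zpow E R n u) < r + \<eta> \<and> dist f (zpow F Q n v) < r + \<eta>" if \<eta>: "\<eta> > 0" for \<eta>
    proof -
      have h: "\<eta> / 2 > 0" using \<eta> by simp
      obtain \<delta>1 where \<delta>1: "\<delta>1 > 0" "\<forall>x\<in>E. \<forall>y\<in>E. dist x y < \<delta>1 \<longrightarrow>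
          (\<forall>n. dist (zpow E R n x) (zpow E R n y) < \<eta> / 2)"
        using E h unfolding equicontinuous_system_def by blast
      obtain \<delta>2 where \<delta>2: "\<delta>2 > 0" "\<forall>x\<in>F. \<forall>y\<in>F. dist x y < \<delta>2 \<longrightarrow>
          (\<forall>n. dist (zpow F Q n x) (zpow F Q n y) < \<eta> / 2)"
        using F h unfolding equicontinuous_system_def by blast
      have "0 < min \<delta>1 \<delta>2" using \<delta>1 \<delta>2 by simp
      then obtain w' where w': "w' \<in> orbit_tube E R e F Q f r" "dist w' w < min \<delta>1 \<delta>2"
        using w unfolding closure_approachable by blast
      obtain a b where ab: "w' = (a, b)" by force
      have abEF: "a \<in> E" "b \<in> F" using w'(1) by (auto simp: ab orbit_tube_def)
      obtain n where n: "dist e (zpow E R n a) < r + \<eta> / 2" "dist f (zpow F Q n b) < r + \<eta> / 2"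
        using w'(1) h unfolding ab orbit_tube_def by blast
      have "dist a u < \<delta>1" "dist b v < \<delta>2"
        using w'(2) dist_fst_le[of w' w] dist_snd_le[of w' w] by (auto simp: ab uv)
      then have "dist (zpow E R n a) (zpow E R n u) < \<eta> / 2" "dist (zpow F Q n b) (zpow F Q n v) < \<eta> / 2"
        using \<delta>1(2) \<delta>2(2) uvEF abEF by blast+
      then show ?thesis
        using n dist_triangle[of e "zpow E R n u" "zpow E R n a"]
          dist_triangle[of f "zpow F Q n v" "zpow F Q n b"]
        by (intro exI[of _ n]) linarith
    qed
    then show ?thesis using uvEF by (simp add: uv orbit_tube_def)
  qed
  then show ?thesis using closure_subset_eq by blast
qed

section \<open>Compact group actions\<close>

lemma continuous_map_dist:
  fixes f g :: "'a \<Rightarrow> 'b::metric_space"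
  assumes "continuous_map X euclidean f" "continuous_map X euclidean g"
  shows "continuous_map X euclideanreal (\<lambda>x. dist (f x) (g x))"
proof -
  have "continuous_map X (prod_topology euclidean euclidean) (\<lambda>x. (f x, g x))"
    using assms by (rule continuous_map_pairedI)
  moreover have "continuous_map euclidean euclideanreal (\<lambda>(a :: 'b, b). dist a b)"
    unfolding continuous_map_iff_continuous2 by (simp add: case_prod_beta' continuous_intros)
  ultimately show ?thesis
    using continuous_map_compose[of X euclidean "\<lambda>x. (f x, g x)" euclideanreal "\<lambda>(a, b). dist a b"]
    by (simp add: o_def)
qed

lemma closedin_Collect_ball_le:
  assumes "\<And>i. i \<in> I \<Longrightarrow> continuous_map X euclideanreal (f i)"
  shows "closedin X {x \<in> topspace X. \<forall>i\<in>I. f i x \<le> e}"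
proof -
  have "openin X {x \<in> topspace X. f i x \<in> {e<..}}" if "i \<in> I" for i
    using assms[OF that] by (intro openin_continuous_map_preimage) auto
  then have "openin X (\<Union>i\<in>I. {x \<in> topspace X. f i x \<in> {e<..}})" by blast
  moreover have "topspace X - {x \<in> topspace X. \<forall>i\<in>I. f i x \<le> e} =
      (\<Union>i\<in>I. {x \<in> topspace X. f i x \<in> {e<..}})"
    by (auto simp: not_le)
  ultimately show ?thesis by (simp add: closedin_def)
qed

lemma continuous_action_compose:
  assumes act: "continuous_action G \<tau> act X"
    and f: "continuous_map P \<tau> f" and h: "continuous_map P (top_of_set X) h"
  shows "continuous_map P (top_of_set X) (\<lambda>w. act (f w) (h w))"
proof -
  have "continuous_map (prod_topology \<tau> (top_of_set X)) (top_of_set X) (\<lambda>(g, x). act g x)"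
    using act by (simp add: continuous_action_def)
  from continuous_map_compose[OF continuous_map_pairedI[OF f h] this]
  show ?thesis by (simp add: o_def)
qed

lemma action_closed:
  assumes G: "compact_group G \<tau>" and act: "continuous_action G \<tau> act X"
    and "g \<in> carrier G" "x \<in> X"
  shows "act g x \<in> X"
proof -
  have "continuous_map \<tau> (top_of_set X) (\<lambda>k. act k x)"
    by (rule continuous_action_compose[OF act, of _ "\<lambda>k. k" "\<lambda>_. x"])
      (use assms in \<open>auto simp: continuous_map_id[unfolded id_def]\<close>)
  then show ?thesis
    using assms G by (auto simp: continuous_map_def compact_group_def)
qed

lemma continuous_on_action:
  assumes G: "compact_group G \<tau>" and act: "continuous_action G \<tau> act X" and g: "g \<in> carrier G"
  shows "continuous_on X (act g)"
proof -
  have "continuous_map (top_of_set X) (top_of_set X) (\<lambda>x. act g x)"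
    by (rule continuous_action_compose[OF act, of _ "\<lambda>_. g" "\<lambda>x. x"])
      (use G g in \<open>auto simp: compact_group_def continuous_map_id[unfolded id_def]\<close>)
  then show ?thesis by (simp add: continuous_map_in_subtopology)
qed

lemma action_inv_cancel:
  assumes G: "compact_group G \<tau>" and act: "continuous_action G \<tau> act X"
    and g: "g \<in> carrier G" and x: "x \<in> X"
  shows "act g (act (inv\<^bsub>G\<^esub> g) x) = x" "act (inv\<^bsub>G\<^esub> g) (act g x) = x"
proof -
  have gr: "group G" using G by (simp add: compact_group_def)
  have i: "inv\<^bsub>G\<^esub> g \<in> carrier G" using gr g by (rule group.inv_closed)
  have mul: "act (a \<otimes>\<^bsub>G\<^esub> b) x = act a (act b x)" if "a \<in> carrier G" "b \<in> carrier G" for a b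
    using act x that by (simp add: continuous_action_def)
  have one: "act \<one>\<^bsub>G\<^esub> x = x" using act x by (simp add: continuous_action_def)
  show "act g (act (inv\<^bsub>G\<^esub> g) x) = x"
    using mul[OF g i] one group.r_inv[OF gr g] by simp
  show "act (inv\<^bsub>G\<^esub> g) (act g x) = x"
    using mul[OF i g] one group.l_inv[OF gr g] by simp
qed

text \<open>Because the action commutes with \<open>T\<close>, \<open>p \<circ> act g\<close> is
  again a factor map onto an equicontinuous system and hence a function of \<open>p\<close>. So the
  action descends to \<open>E\<close>.\<close>

lemma action_respects_factor:
  fixes X :: "'a::metric_space set" and E :: "'e::metric_space set"
  assumes G: "compact_group G \<tau>" and act: "continuous_action G \<tau> act X"
    and comm: "\<And>g x. g \<in> carrier G \<Longrightarrow> x \<in> X \<Longrightarrow> act g (T x) = T (act g x)"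
    and mef: "max_equicontinuous_factor X T E R p"
    and g: "g \<in> carrier G" and xy: "x \<in> X" "y \<in> X" "p x = p y"
  shows "p (act g x) = p (act g y)"
proof -
  have E: "equicontinuous_system E R" and p: "factor_map X T E R p"
    using mef by (auto simp: max_equicontinuous_factor_def)
  have i: "inv\<^bsub>G\<^esub> g \<in> carrier G" using G g by (simp add: compact_group_def group.inv_closed)
  have "factor_map X T X T (act g)"
    unfolding factor_map_def
  proof (intro conjI ballI)
    show "continuous_on X (act g)" by (rule continuous_on_action[OF G act g])
    show "act g ` X = X"
    proof
      show "act g ` X \<subseteq> X" using action_closed[OF G act g] by blast
      show "X \<subseteq> act g ` X"
      proof
        fix x assume x: "x \<in> X"
        then show "x \<in> act g ` X"
          using action_inv_cancel(1)[OF G act g x] action_closed[OF G act i x] by (metis image_eqI)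
      qed
    qed
    show "act g (T x) = T (act g x)" if "x \<in> X" for x using comm[OF g that] .
  qed
  from factor_map_comp[OF this p] have "factor_map X T E R (p \<circ> act g)" .
  from max_equicontinuous_factor_universal[OF mef E this]
  obtain h where "\<forall>x\<in>X. (p \<circ> act g) x = h (p x)" by blast
  then show ?thesis using xy by simp
qed

text \<open>The group carries only a topology, so closeness means uniform closeness of the actions
  on \<open>X\<close>. Such neighbourhoods are open: the bad pairs form a closed set, and projecting
  along the compact \<open>X\<close> keeps it closed.\<close>

lemma finite_net_of_action:
  fixes X :: "'a::metric_space set"
  assumes G: "compact_group G \<tau>" and act: "continuous_action G \<tau> act X" and X: "compact X"
    and e: "e > 0"
  shows "\<exists>K. finite K \<and> K \<subseteq> carrier G \<and> (\<forall>k\<in>carrier G. \<exists>g\<in>K. \<forall>u\<in>X. dist (act k u) (act g u) \<le> e)"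
proof -
  have top: "topspace \<tau> = carrier G" and cpt: "compact_space \<tau>"
    using G by (auto simp: compact_group_def)
  define P where "P = prod_topology \<tau> (top_of_set X)"
  define O' where "O' g = {k \<in> carrier G. \<forall>u\<in>X. dist (act k u) (act g u) < e}" for g
  have op: "openin \<tau> (O' g)" if g: "g \<in> carrier G" for g
  proof -
    define D where "D = {w \<in> topspace P. dist (act (fst w) (snd w)) (act g (snd w)) \<in> {e..}}"
    have a: "continuous_map P (top_of_set X) (\<lambda>w. act (fst w) (snd w))"
      by (rule continuous_action_compose[OF act]) (auto simp: P_def intro: continuous_map_fst continuous_map_snd)
    have b: "continuous_map P (top_of_set X) (\<lambda>w. act g (snd w))"
      by (rule continuous_action_compose[OF act]) (use g top in \<open>auto simp: P_def intro: continuous_map_snd\<close>)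
    have "continuous_map P euclideanreal (\<lambda>w. dist (act (fst w) (snd w)) (act g (snd w)))"
      by (rule continuous_map_dist[OF a[THEN continuous_map_into_fulltopology]
            b[THEN continuous_map_into_fulltopology]])
    then have "closedin P D" unfolding D_def by (rule closedin_continuous_map_preimage) simp
    moreover have "closed_map P \<tau> fst"
      unfolding P_def using X by (intro Abstract_Topological_Spaces.closed_map_fst)
        (simp add: compact_space_subtopology)
    ultimately have "closedin \<tau> (fst ` D)" by (simp add: closed_map_def)
    moreover have "O' g = topspace \<tau> - fst ` D"
      by (force simp: O'_def D_def P_def top not_less)
    ultimately show ?thesis by (simp add: openin_diff)
  qed
  have "(\<forall>U\<in>O' ` carrier G. openin \<tau> U) \<and> topspace \<tau> \<subseteq> \<Union>(O' ` carrier G)"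
    using op e by (auto simp: top O'_def)
  then have "\<exists>\<F>. finite \<F> \<and> \<F> \<subseteq> O' ` carrier G \<and> topspace \<tau> \<subseteq> \<Union>\<F>"
    using cpt unfolding compact_space_alt by (elim allE[of _ "O' ` carrier G"]) (rule mp)
  then obtain \<F> where F: "finite \<F>" "\<F> \<subseteq> O' ` carrier G" "topspace \<tau> \<subseteq> \<Union>\<F>"
    by blast
  obtain K where K: "K \<subseteq> carrier G" "finite K" "\<F> = O' ` K"
    using finite_subset_image[OF F(1,2)] by blast
  have "\<exists>g\<in>K. \<forall>u\<in>X. dist (act k u) (act g u) \<le> e" if "k \<in> carrier G" for k
  proof -
    have "k \<in> \<Union>(O' ` K)" using that F(3) unfolding K(3) top by (rule subsetD[rotated])
    then obtain g where "g \<in> K" "k \<in> O' g" by blast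
    then show ?thesis by (intro bexI[of _ g]) (auto simp: O'_def intro: less_imp_le)
  qed
  then show ?thesis using K by blast
qed

text \<open>The set is the projection along the compact group of a closed subset of the product of
  the group with \<open>X \<times> Z\<close>; the non-strict bound keeps that subset closed.\<close>

lemma closed_near_translates:
  fixes X :: "'a::metric_space set" and Z :: "'c::metric_space set"
  assumes G: "compact_group G \<tau>" and act: "continuous_action G \<tau> act X"
    and X: "compact X" and Z: "compact Z" and H: "closed H" and g: "g \<in> carrier G"
  shows "closed {w \<in> X \<times> Z. \<exists>k\<in>carrier G. (\<forall>u\<in>X. dist (act k u) (act g u) \<le> e) \<and>
      (act k (fst w), snd w) \<in> H}" (is "closed ?L")
proof -
  have top: "topspace \<tau> = carrier G" and cpt: "compact_space \<tau>"
    using G by (auto simp: compact_group_def)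
  define P where "P = prod_topology \<tau> (top_of_set (X \<times> Z))"
  have cfst: "continuous_map P \<tau> fst" and csnd: "continuous_map P (top_of_set (X \<times> Z)) snd"
    by (auto simp: P_def intro: continuous_map_fst continuous_map_snd)
  have tP: "topspace P = carrier G \<times> (X \<times> Z)" by (simp add: P_def top)
  have "continuous_map P euclideanreal (\<lambda>w. dist (act (fst w) u) (act g u))" if u: "u \<in> X" for u
  proof (rule continuous_map_dist)
    have "continuous_map P (top_of_set X) (\<lambda>w. act (fst w) u)"
      by (rule continuous_action_compose[OF act]) (use u cfst in auto)
    then show "continuous_map P euclidean (\<lambda>w. act (fst w) u)"
      by (rule continuous_map_into_fulltopology)
  qed simp
  then have 1: "closedin P {w \<in> topspace P. \<forall>u\<in>X. dist (act (fst w) u) (act g u) \<le> e}"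
    by (rule closedin_Collect_ball_le)
  have "continuous_map (top_of_set (X \<times> Z)) (top_of_set X) fst"
    "continuous_map (top_of_set (X \<times> Z)) (top_of_set Z) snd"
    by (auto simp: continuous_map_in_subtopology continuous_on_fst continuous_on_snd continuous_on_id)
  note this[THEN continuous_map_compose[OF csnd]]
  then have "continuous_map P (top_of_set X) (\<lambda>w. fst (snd w))"
    and c2: "continuous_map P (top_of_set Z) (\<lambda>w. snd (snd w))"
    by (simp_all only: o_def)
  then have c1: "continuous_map P (top_of_set X) (\<lambda>w. act (fst w) (fst (snd w)))"
    using cfst by (intro continuous_action_compose[OF act])
  have "continuous_map P (prod_topology euclidean euclidean)
      (\<lambda>w. (act (fst w) (fst (snd w)), snd (snd w)))"
    by (rule continuous_map_pairedI[OF c1[THEN continuous_map_into_fulltopology]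
          c2[THEN continuous_map_into_fulltopology]])
  then have "continuous_map P euclidean (\<lambda>w. (act (fst w) (fst (snd w)), snd (snd w)))"
    by simp
  then have 2: "closedin P {w \<in> topspace P. (act (fst w) (fst (snd w)), snd (snd w)) \<in> H}"
    using H by (intro closedin_continuous_map_preimage) auto
  have "closed_map P (top_of_set (X \<times> Z)) snd"
    unfolding P_def by (rule Abstract_Topological_Spaces.closed_map_snd[OF cpt])
  with closedin_Int[OF 1 2] have "closedin (top_of_set (X \<times> Z))
      (snd ` ({w \<in> topspace P. \<forall>u\<in>X. dist (act (fst w) u) (act g u) \<le> e} \<inter>
       {w \<in> topspace P. (act (fst w) (fst (snd w)), snd (snd w)) \<in> H}))"
    by (simp add: closed_map_def)
  also have "snd ` ({w \<in> topspace P. \<forall>u\<in>X. dist (act (fst w) u) (act g u) \<le> e} \<inter>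
       {w \<in> topspace P. (act (fst w) (fst (snd w)), snd (snd w)) \<in> H}) = ?L"
  proof (intro equalityI subsetI)
    fix w assume "w \<in> ?L"
    then obtain k where "k \<in> carrier G" "\<forall>u\<in>X. dist (act k u) (act g u) \<le> e"
      "(act k (fst w), snd w) \<in> H" "w \<in> X \<times> Z" by blast
    then show "w \<in> snd ` ({w \<in> topspace P. \<forall>u\<in>X. dist (act (fst w) u) (act g u) \<le> e} \<inter>
       {w \<in> topspace P. (act (fst w) (fst (snd w)), snd (snd w)) \<in> H})"
      by (intro image_eqI[of _ _ "(k, w)"]) (auto simp: tP)
  qed (auto simp: tP)
  finally show ?thesis
    using closedin_compact[OF compact_Times[OF X Z]] compact_imp_closed by blast
qed

text \<open>The assumption \<open>UH\<close> gives a group element for each single point. Finite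
  nets in the group produce countably many closed invariant sets \<open>L n g\<close>. At a point
  generic for all of them, \<open>relatively_ergodic\<close> spreads membership over the whole
  fibre, and compactness of the group removes the remaining error.\<close>

lemma fibre_in_translate:
  fixes X :: "'a::metric_space set" and Z :: "'c::metric_space set"
    and E :: "'e::metric_space set" and F :: "'f::metric_space set"
  assumes X: "minimal_system X T" and Z: "minimal_system Z S"
    and mefX: "max_equicontinuous_factor X T E R p" and mefZ: "max_equicontinuous_factor Z S F Q q"
    and G: "compact_group G \<tau>" and act: "continuous_action G \<tau> act X"
    and comm: "\<And>g x. g \<in> carrier G \<Longrightarrow> x \<in> X \<Longrightarrow> act g (T x) = T (act g x)"
    and H: "closed H" "H \<subseteq> X \<times> Z" "map_prod T S ` H = H"
    and U: "open U" "U \<inter> (X \<times> Z) \<noteq> {}"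
    and UH: "\<And>x z. (x, z) \<in> U \<Longrightarrow> x \<in> X \<Longrightarrow> z \<in> Z \<Longrightarrow> \<exists>g\<in>carrier G. (act g x, z) \<in> H"
  obtains x z g where "x \<in> X" "z \<in> Z" "g \<in> carrier G"
    "\<And>x' z'. x' \<in> X \<Longrightarrow> z' \<in> Z \<Longrightarrow> p x' = p x \<Longrightarrow> q z' = q z \<Longrightarrow> (act g x', z') \<in> H"
proof -
  have dX: "dynamical_system X T" and dZ: "dynamical_system Z S"
    using X Z by (auto simp: minimal_system_def)
  note X' = dynamical_systemD[OF dX] and Z' = dynamical_systemD[OF dZ]
  have top: "topspace \<tau> = carrier G" and cpt: "compact_space \<tau>"
    using G by (auto simp: compact_group_def)
  have bij: "bij_betw (map_prod T S) (X \<times> Z) (X \<times> Z)"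
    using X'(3) Z'(3) by (rule bij_betw_map_prod)
  have TX: "T u \<in> X" if "u \<in> X" for u using X'(3) that by (auto simp: bij_betw_def)
  have SZ: "S u \<in> Z" if "u \<in> Z" for u using Z'(3) that by (auto simp: bij_betw_def)
  have Hinv: "(T u, S w) \<in> H \<longleftrightarrow> (u, w) \<in> H" if "u \<in> X" "w \<in> Z" for u w
    using image_eq_iff_invariant[OF bij H(2)] H(3) that by auto
  define L where "L n g = {w \<in> X \<times> Z. \<exists>k\<in>carrier G.
      (\<forall>u\<in>X. dist (act k u) (act g u) \<le> 1 / real (Suc n)) \<and> (act k (fst w), snd w) \<in> H}"
    for n :: nat and g
  have Lcl: "closed (L n g)" if "g \<in> carrier G" for n g
    unfolding L_def by (rule closed_near_translates[OF G act X'(1) Z'(1) H(1) that])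
  have Linv: "map_prod T S ` L n g = L n g" for n g
  proof -
    have LW: "L n g \<subseteq> X \<times> Z" by (auto simp: L_def)
    have "(T u, S w) \<in> L n g \<longleftrightarrow> (u, w) \<in> L n g" if uw: "u \<in> X" "w \<in> Z" for u w
    proof -
      have "(act k (T u), S w) \<in> H \<longleftrightarrow> (act k u, w) \<in> H" if "k \<in> carrier G" for k
        using Hinv[OF action_closed[OF G act that uw(1)] uw(2)] comm[OF that uw(1)] by simp
      then show ?thesis using uw TX SZ by (auto simp: L_def)
    qed
    then show ?thesis unfolding image_eq_iff_invariant[OF bij LW] by auto
  qed
  have "\<forall>n. \<exists>K. finite K \<and> K \<subseteq> carrier G \<and>
      (\<forall>k\<in>carrier G. \<exists>g\<in>K. \<forall>u\<in>X. dist (act k u) (act g u) \<le> 1 / real (Suc n))"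
    by (intro allI finite_net_of_action[OF G act X'(1)]) simp
  from choice[OF this] obtain K where K: "\<forall>n. finite (K n) \<and> K n \<subseteq> carrier G \<and>
      (\<forall>k\<in>carrier G. \<exists>g\<in>K n. \<forall>u\<in>X. dist (act k u) (act g u) \<le> 1 / real (Suc n))" ..
  define \<L> where "\<L> = (\<Union>n. L n ` K n)"
  have cnt: "countable \<L>"
    unfolding \<L>_def using K by (intro countable_UN countable_image) (auto intro: countable_finite)
  have cl: "closed M" if "M \<in> \<L>" for M
    using that Lcl K by (auto simp: \<L>_def)
  have cq: "continuous_on Z q"
    using mefZ by (simp add: max_equicontinuous_factor_def factor_map_def)
  obtain x z where xz: "(x, z) \<in> U" "x \<in> X" "z \<in> Z" "fibres_lsc_at Z q z"
    and int: "\<And>M. M \<in> \<L> \<Longrightarrow> (x, z) \<in> M \<Longrightarrow> \<exists>V. open V \<and> (x, z) \<in> V \<and> V \<inter> (X \<times> Z) \<subseteq> M"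
    by (rule generic_point_lsc[OF X'(1) Z'(1) cq cnt cl U]) (assumption | rule that)+
  \<comment> \<open>This \<open>k\<close> belongs to the generic point and is the same for all
    \<open>n\<close>; each \<open>A n\<close> below contains a net point near it.\<close>
  obtain k where k: "k \<in> carrier G" "(act k x, z) \<in> H" using UH xz by blast
  have Hne: "H \<noteq> {}" using k(2) by blast
  define I where "I = {w \<in> X \<times> Z. p (fst w) = p x \<and> q (snd w) = q z}"
  \<comment> \<open>Distance to \<open>H\<close> instead of membership makes these sets closed and
    nested, so that a single group element lies in all of them.\<close>
  define A where "A n = {g \<in> topspace \<tau>. \<forall>w\<in>I. infdist (act g (fst w), snd w) H \<le> 1 / real (Suc n)}"
    for n
  have "closedin \<tau> (A n)" for n
    unfolding A_def
  proof (rule closedin_Collect_ball_le)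
    fix w assume "w \<in> I"
    then have w: "fst w \<in> X" by (auto simp: I_def)
    have "continuous_map \<tau> (top_of_set X) (\<lambda>g. act g (fst w))"
      by (rule continuous_action_compose[OF act, of _ "\<lambda>k. k" "\<lambda>_. fst w"])
        (use w in \<open>auto simp: continuous_map_id[unfolded id_def]\<close>)
    moreover have "continuous_on X (\<lambda>u. infdist (u, snd w) H)"
      by (intro continuous_intros)
    then have "continuous_map (top_of_set X) euclideanreal (\<lambda>u. infdist (u, snd w) H)" by simp
    ultimately show "continuous_map \<tau> euclideanreal (\<lambda>g. infdist (act g (fst w), snd w) H)"
      by (rule continuous_map_compose[unfolded o_def])
  qed
  moreover have "A n \<noteq> {}" for n
  proof -
    obtain g where g: "g \<in> K n" "\<forall>u\<in>X. dist (act k u) (act g u) \<le> 1 / real (Suc n)"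
      using K k(1) by blast
    have gG: "g \<in> carrier G" using g(1) K by blast
    have "(x, z) \<in> L n g" unfolding L_def using xz k g(2) by auto
    moreover have "L n g \<in> \<L>" using g(1) by (auto simp: \<L>_def)
    ultimately obtain V where V: "open V" "(x, z) \<in> V" "V \<inter> (X \<times> Z) \<subseteq> L n g" using int by blast
    have LW: "L n g \<subseteq> X \<times> Z" by (auto simp: L_def)
    have "infdist (act g (fst w), snd w) H \<le> 1 / real (Suc n)" if w: "w \<in> I" for w
    proof -
      \<comment> \<open>The element \<open>j\<close> found from this may vary with \<open>w\<close>,
        but it stays near the fixed \<open>g\<close>, which costs only the distance bound.\<close>
      have "(fst w, snd w) \<in> L n g"
        by (rule relatively_ergodic[OF X Z mefX mefZ Lcl[OF gG] LW Linv V xz(2) _ _ xz(3) _ _ xz(4)])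
          (use w in \<open>auto simp: I_def\<close>)
      then obtain j where j: "j \<in> carrier G" "\<forall>u\<in>X. dist (act j u) (act g u) \<le> 1 / real (Suc n)"
        "(act j (fst w), snd w) \<in> H" by (auto simp: L_def)
      have "infdist (act g (fst w), snd w) H \<le> dist (act g (fst w), snd w) (act j (fst w), snd w)"
        using j(3) by (rule infdist_le)
      also have "\<dots> = dist (act j (fst w)) (act g (fst w))"
        by (simp add: dist_Pair_Pair dist_commute)
      also have "\<dots> \<le> 1 / real (Suc n)" using j(2) w by (auto simp: I_def)
      finally show ?thesis .
    qed
    then have "g \<in> A n" using gG by (simp add: A_def top)
    then show ?thesis by blast
  qed
  moreover have "decseq A"
  proof (rule decseq_SucI)
    fix n
    have "1 / real (Suc (Suc n)) \<le> 1 / real (Suc n)" by (simp add: frac_le)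
    then show "A (Suc n) \<subseteq> A n" unfolding A_def using order_trans by blast
  qed
  ultimately have "(\<Inter>n. A n) \<noteq> {}" by (intro compact_space_imp_nest[OF cpt])
  then obtain g where g: "\<And>n. g \<in> A n" by blast
  have gG: "g \<in> carrier G" using g[of 0] by (simp add: A_def top)
  have "(act g x', z') \<in> H" if "x' \<in> X" "z' \<in> Z" "p x' = p x" "q z' = q z" for x' z'
  proof -
    have "(x', z') \<in> I" using that by (simp add: I_def)
    then have le: "infdist (act g x', z') H \<le> 1 / real (Suc n)" for n
      using g[of n] by (force simp: A_def)
    have "infdist (act g x', z') H = 0"
    proof (rule ccontr)
      assume "infdist (act g x', z') H \<noteq> 0"
      then have "0 < infdist (act g x', z') H" using infdist_nonneg by (simp add: less_le)
      then obtain n where "1 / real (Suc n) < infdist (act g x', z') H" by (rule nat_approx_posE)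
      then show False using le[of n] by simp
    qed
    then show ?thesis using in_closed_iff_infdist_zero[OF H(1) Hne] by simp
  qed
  then show thesis by (rule that[OF xz(2,3) gG])
qed

section \<open>Joinings of a group extension\<close>

text \<open>Full projections come from minimality: the projections of a nonempty closed invariant
  set are nonempty, closed and invariant. Compactness keeps the image closed.\<close>

lemma joining_image_factor:
  fixes X :: "'a::metric_space set" and Y :: "'b::metric_space set" and Z :: "'c::metric_space set"
  assumes X: "minimal_system X T" and Z: "minimal_system Z S" and p: "factor_map X T Y R p"
    and J: "closed J" "J \<subseteq> X \<times> Z" "map_prod T S ` J = J" "J \<noteq> {}"
  shows "joining Y R Z S (map_prod p id ` J)"
proof -
  have dX: "dynamical_system X T" and dZ: "dynamical_system Z S"
    using X Z by (auto simp: minimal_system_def)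
  have cp: "continuous_on X p" and pX: "p ` X = Y" and pT: "\<And>x. x \<in> X \<Longrightarrow> p (T x) = R (p x)"
    using p by (auto simp: factor_map_def)
  have cJ: "compact J"
    by (rule compact_subset_closed[OF J(1,2) compact_Times[OF dynamical_systemD(1)[OF dX] dynamical_systemD(1)[OF dZ]]])
  have "continuous_on J (\<lambda>w. (p (fst w), snd w))"
    using J(2) by (intro continuous_on_Pair continuous_on_compose2[OF cp] continuous_intros) auto
  then have "continuous_on J (map_prod p id)" by (simp add: map_prod_def case_prod_beta')
  then have "closed (map_prod p id ` J)"
    using cJ compact_continuous_image compact_imp_closed by blast
  moreover have "map_prod R S ` map_prod p id ` J = map_prod p id ` map_prod T S ` J"
    unfolding image_image using J(2) pT by (intro image_cong) auto
  moreover have "fst ` J = X"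
  proof (rule minimal_invariant_closed[OF X])
    show "closed (fst ` J)"
      by (intro compact_imp_closed compact_continuous_image cJ continuous_on_fst continuous_on_id)
    have "T ` fst ` J = fst ` map_prod T S ` J" unfolding image_image by (intro image_cong) auto
    then show "T ` fst ` J \<subseteq> fst ` J" by (simp add: J(3))
  qed (use J in auto)
  moreover have "snd ` J = Z"
  proof (rule minimal_invariant_closed[OF Z])
    show "closed (snd ` J)"
      by (intro compact_imp_closed compact_continuous_image cJ continuous_on_snd continuous_on_id)
    have "S ` snd ` J = snd ` map_prod T S ` J" unfolding image_image by (intro image_cong) auto
    then show "S ` snd ` J \<subseteq> snd ` J" by (simp add: J(3))
  qed (use J in auto)
  moreover have "fst ` map_prod p id ` J = p ` fst ` J" "snd ` map_prod p id ` J = snd ` J"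
    by (auto simp: image_image)
  moreover have "map_prod p id ` J \<subseteq> Y \<times> Z" using J(2) pX by auto
  ultimately show ?thesis
    unfolding joining_def using J(3) pX by simp
qed

text \<open>A point off \<open>J\<close> has a product neighbourhood off \<open>J\<close>, and
  semi-openness turns its two factors into open sets of \<open>E\<close> and \<open>F\<close>. A
  point of the tube enters them at a common time \<open>n\<close>, lifts there to a point off
  \<open>J\<close>, and time \<open>- n\<close> brings the lift back to the original fibre.\<close>

lemma fibre_avoiding_tube:
  fixes X :: "'a::metric_space set" and Z :: "'c::metric_space set"
    and E :: "'e::metric_space set" and F :: "'f::metric_space set"
  assumes X: "minimal_system X T" and Z: "minimal_system Z S"
    and E: "dynamical_system E RE" and F: "dynamical_system F Q"
    and p: "factor_map X T E RE p" and q: "factor_map Z S F Q q"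
    and J: "closed J" "J \<subseteq> X \<times> Z" "map_prod T S ` J = J" "J \<noteq> X \<times> Z"
  obtains e f r where "e \<in> E" "f \<in> F" "r > 0"
    "\<And>u v. (u, v) \<in> orbit_tube E RE e F Q f r \<Longrightarrow>
       \<exists>x\<in>X. \<exists>z\<in>Z. p x = u \<and> q z = v \<and> (x, z) \<notin> J"
proof -
  have dX: "dynamical_system X T" and dZ: "dynamical_system Z S"
    using X Z by (auto simp: minimal_system_def)
  have bij: "bij_betw (map_prod T S) (X \<times> Z) (X \<times> Z)"
    using dynamical_systemD(3)[OF dX] dynamical_systemD(3)[OF dZ] by (rule bij_betw_map_prod)
  have Jinv: "(T u, S w) \<in> J \<longleftrightarrow> (u, w) \<in> J" if "u \<in> X" "w \<in> Z" for u w
    using image_eq_iff_invariant[OF bij J(2)] J(3) that by auto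
  obtain x0 z0 where xz0: "x0 \<in> X" "z0 \<in> Z" "(x0, z0) \<notin> J" using J(2,4) by auto
  have "open (- J)" "(x0, z0) \<in> - J" using J(1) xz0(3) by auto
  then obtain U W where UW: "open U" "open W" "x0 \<in> U" "z0 \<in> W" "U \<times> W \<subseteq> - J"
    by (elim open_prod_elim) auto
  have "U \<inter> X \<noteq> {}" "W \<inter> Z \<noteq> {}" using UW xz0 by auto
  obtain V1 where V1: "open V1" "V1 \<inter> E \<noteq> {}" "V1 \<inter> E \<subseteq> p ` (U \<inter> X)"
    using minimal_factor_semiopen[OF X E p UW(1) \<open>U \<inter> X \<noteq> {}\<close>] by blast
  obtain V2 where V2: "open V2" "V2 \<inter> F \<noteq> {}" "V2 \<inter> F \<subseteq> q ` (W \<inter> Z)"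
    using minimal_factor_semiopen[OF Z F q UW(2) \<open>W \<inter> Z \<noteq> {}\<close>] by blast
  obtain e f where ef: "e \<in> V1" "e \<in> E" "f \<in> V2" "f \<in> F" using V1(2) V2(2) by blast
  obtain r1 where r1: "r1 > 0" "ball e r1 \<subseteq> V1" using V1(1) ef(1) by (rule openE)
  obtain r2 where r2: "r2 > 0" "ball f r2 \<subseteq> V2" using V2(1) ef(3) by (rule openE)
  \<comment> \<open>Half the radius leaves room for the slack: with \<open>\<eta> = r\<close> the
    tube gives distances below \<open>r + r\<close>.\<close>
  define r where "r = min r1 r2 / 2"
  have r: "r > 0" "r + r \<le> r1" "r + r \<le> r2" using r1 r2 by (auto simp: r_def)
  show thesis
  proof (rule that[OF ef(2,4) r(1)])
    fix u v assume uv: "(u, v) \<in> orbit_tube E RE e F Q f r"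
    then have uvEF: "u \<in> E" "v \<in> F" by (auto simp: orbit_tube_def)
    obtain n where n: "dist e (zpow E RE n u) < r + r" "dist f (zpow F Q n v) < r + r"
      using uv r(1) unfolding orbit_tube_def by blast
    have "zpow E RE n u \<in> ball e r1" "zpow F Q n v \<in> ball f r2" using n r by auto
    then have "zpow E RE n u \<in> p ` (U \<inter> X)" "zpow F Q n v \<in> q ` (W \<inter> Z)"
      using r1(2) r2(2) V1(3) V2(3) zpow_closed[OF E uvEF(1)] zpow_closed[OF F uvEF(2)] by blast+
    then obtain x z where xz: "x \<in> U" "x \<in> X" "zpow E RE n u = p x" "z \<in> W" "z \<in> Z" "zpow F Q n v = q z"
      by blast
    have "(x, z) \<notin> J" using xz UW(5) by blast
    then have "(zpow X T (- n) x, zpow Z S (- n) z) \<notin> J"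
      using zpow_pair_invariant[OF dX dZ Jinv xz(2,5)] by blast
    moreover have "p (zpow X T (- n) x) = u"
      using factor_map_zpow[OF dX E p xz(2)] zpow_uminus_cancel[OF E uvEF(1), of n] xz(3) by simp
    moreover have "q (zpow Z S (- n) z) = v"
      using factor_map_zpow[OF dZ F q xz(5)] zpow_uminus_cancel[OF F uvEF(2), of n] xz(6) by simp
    ultimately show "\<exists>x\<in>X. \<exists>z\<in>Z. p x = u \<and> q z = v \<and> (x, z) \<notin> J"
      using zpow_closed[OF dX xz(2)] zpow_closed[OF dZ xz(5)] by blast
  qed
qed

theorem proposition5p5:
  fixes X :: "'a::metric_space set" and T :: "'a \<Rightarrow> 'a"
    and Y :: "'b::metric_space set" and R :: "'b \<Rightarrow> 'b"
    and Z :: "'c::metric_space set" and S :: "'c \<Rightarrow> 'c"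
    and G :: "('g, 'm) monoid_scheme" and \<tau> :: "'g topology"
    and act :: "'g \<Rightarrow> 'a \<Rightarrow> 'a" and p :: "'a \<Rightarrow> 'b"
  assumes "minimal_system X T" and "minimal_system Z S" and "dynamical_system Y R"
    and "compact_group G \<tau>" and "group_extension G \<tau> act X T Y R p"
    and "quasi_disjoint Y R Z S"
  shows "quasi_disjoint X T Z S"
  unfolding quasi_disjoint_def
proof (intro allI impI, elim conjE)
  fix E :: "(nat \<Rightarrow> real) set" and RE \<pi> and F :: "(nat \<Rightarrow> real) set" and Q q J
  assume mX: "max_equicontinuous_factor X T E RE \<pi>" and mZ: "max_equicontinuous_factor Z S F Q q"
    and J: "joining X T Z S J" and onto: "map_prod \<pi> q ` J = E \<times> F"
  note X = assms(1) and Z = assms(2) and Y = assms(3) and G = assms(4)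
  have p: "factor_map X T Y R p" and act: "continuous_action G \<tau> act X"
    and comm: "\<And>g x. g \<in> carrier G \<Longrightarrow> x \<in> X \<Longrightarrow> act g (T x) = T (act g x)"
    and fib: "\<And>x. x \<in> X \<Longrightarrow> {x'\<in>X. p x' = p x} = (\<lambda>g. act g x) ` carrier G"
    using assms(5) by (auto simp: group_extension_def)
  have dX: "dynamical_system X T" and dZ: "dynamical_system Z S"
    using X Z by (auto simp: minimal_system_def)
  note X' = dynamical_systemD[OF dX] and Z' = dynamical_systemD[OF dZ]
  have TX: "T u \<in> X" if "u \<in> X" for u using X'(3) that by (auto simp: bij_betw_def)
  have SZ: "S u \<in> Z" if "u \<in> Z" for u using Z'(3) that by (auto simp: bij_betw_def)
  have bij: "bij_betw (map_prod T S) (X \<times> Z) (X \<times> Z)"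
    using X'(3) Z'(3) by (rule bij_betw_map_prod)
  have Jc: "closed J" and JXZ: "J \<subseteq> X \<times> Z" and JT: "map_prod T S ` J = J"
    using J by (auto simp: joining_def)
  have Jinv: "(T u, S w) \<in> J \<longleftrightarrow> (u, w) \<in> J" if "u \<in> X" "w \<in> Z" for u w
    using image_eq_iff_invariant[OF bij JXZ] JT that by auto
  have eE: "equicontinuous_system E RE" and fE: "factor_map X T E RE \<pi>"
    and eF: "equicontinuous_system F Q" and fF: "factor_map Z S F Q q"
    using mX mZ by (auto simp: max_equicontinuous_factor_def)
  have dE: "dynamical_system E RE" and dF: "dynamical_system F Q"
    using eE eF by (auto simp: equicontinuous_system_def)
  have \<pi>: "continuous_on X \<pi>" "\<pi> ` X = E" "\<And>x. x \<in> X \<Longrightarrow> \<pi> (T x) = RE (\<pi> x)"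
    using fE by (auto simp: factor_map_def)
  have q: "continuous_on Z q" "q ` Z = F" "\<And>z. z \<in> Z \<Longrightarrow> q (S z) = Q (q z)"
    using fF by (auto simp: factor_map_def)
  \<comment> \<open>A realisation \<open>A\<close> of the maximal equicontinuous factor of
    \<open>Y\<close>; the composite \<open>a\<close> from \<open>X\<close> to \<open>A\<close>
    factors through \<open>E\<close> because \<open>A\<close> is equicontinuous.\<close>
  obtain A :: "(nat \<Rightarrow> real) set" and RA b where mY: "max_equicontinuous_factor Y R A RA b"
    using max_equicontinuous_factor_exists[OF Y] by blast
  have eA: "equicontinuous_system A RA" and fA: "factor_map Y R A RA b"
    using mY by (auto simp: max_equicontinuous_factor_def)
  have dA: "dynamical_system A RA" using eA by (simp add: equicontinuous_system_def)
  define a where "a = b \<circ> p"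
  have fa: "factor_map X T A RA a" unfolding a_def by (rule factor_map_comp[OF p fA])
  then have a: "continuous_on X a" "a ` X = A" "\<And>x. x \<in> X \<Longrightarrow> a (T x) = RA (a x)"
    by (auto simp: factor_map_def)
  obtain h where h: "\<And>x. x \<in> X \<Longrightarrow> a x = h (\<pi> x)"
    using max_equicontinuous_factor_universal[OF mX eA fa] by blast
  show "J = X \<times> Z"
  proof (rule ccontr)
    assume "J \<noteq> X \<times> Z"
    then obtain e f r where ef: "e \<in> E" "f \<in> F" "r > 0"
      and avoid: "\<And>u v. (u, v) \<in> orbit_tube E RE e F Q f r \<Longrightarrow>
       \<exists>x\<in>X. \<exists>z\<in>Z. \<pi> x = u \<and> q z = v \<and> (x, z) \<notin> J"
      using fibre_avoiding_tube[OF X Z dE dF fE fF Jc JXZ JT] by blast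
    \<comment> \<open>The part of \<open>X \<times> Z\<close> over the tube, a closed invariant set
      that is saturated for \<open>\<pi>\<close> and \<open>q\<close>.\<close>
    define C where "C = {w \<in> X \<times> Z. (\<pi> (fst w), q (snd w)) \<in> orbit_tube E RE e F Q f r}"
    have Cc: "closed C"
    proof -
      have "continuous_on (X \<times> Z) (\<lambda>w. (\<pi> (fst w), q (snd w)))"
        by (intro continuous_on_Pair continuous_on_compose2[OF \<pi>(1)] continuous_on_compose2[OF q(1)]
            continuous_intros) auto
      then have "closedin (top_of_set (X \<times> Z))
          (X \<times> Z \<inter> (\<lambda>w. (\<pi> (fst w), q (snd w))) -` orbit_tube E RE e F Q f r)"
        by (rule continuous_closedin_preimage[OF _ closed_orbit_tube[OF eE eF]])
      moreover have "X \<times> Z \<inter> (\<lambda>w. (\<pi> (fst w), q (snd w))) -` orbit_tube E RE e F Q f r = C"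
        by (auto simp: C_def)
      ultimately show ?thesis
        using closedin_compact[OF compact_Times[OF X'(1) Z'(1)]] compact_imp_closed by metis
    qed
    have Cinv: "(T x, S z) \<in> C \<longleftrightarrow> (x, z) \<in> C" if "x \<in> X" "z \<in> Z" for x z
    proof -
      have "\<pi> x \<in> E" "q z \<in> F" using that \<pi>(2) q(2) by auto
      then show ?thesis
        using that TX SZ \<pi>(3) q(3) orbit_tube_invariant[OF dE dF] by (simp add: C_def)
    qed
    have Cball: "(x, z) \<in> C"
      if "x \<in> X" "z \<in> Z" "\<pi> x \<in> ball e r" "q z \<in> ball f r" for x z
    proof -
      have "\<exists>n. dist e (zpow E RE n (\<pi> x)) < r + \<eta> \<and> dist f (zpow F Q n (q z)) < r + \<eta>"
        if "\<eta> > 0" for \<eta>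
        using \<open>\<pi> x \<in> ball e r\<close> \<open>q z \<in> ball f r\<close> that by (intro exI[of _ 0]) simp
      then show ?thesis using that(1,2) \<pi>(2) q(2) by (auto simp: C_def orbit_tube_def)
    qed
    \<comment> \<open>Semi-openness of \<open>a\<close> on the preimage of the ball gives an open
      \<open>V\<close> meeting \<open>A\<close> such that each point of \<open>V \<inter> A\<close>
      has a lift in \<open>X\<close> lying over that ball.\<close>
    obtain B where B: "open B" "B \<inter> X = \<pi> -` ball e r \<inter> X"
      using \<pi>(1) open_ball unfolding continuous_on_open_invariant by meson
    obtain x0 where x0: "x0 \<in> X" "\<pi> x0 = e" using ef(1) \<pi>(2) by auto
    have "x0 \<in> \<pi> -` ball e r \<inter> X" using x0 ef(3) by simp
    then have "B \<inter> X \<noteq> {}" using B(2) by blast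
    then obtain V where V: "open V" "V \<inter> A \<noteq> {}" "V \<inter> A \<subseteq> a ` (B \<inter> X)"
      using minimal_factor_semiopen[OF X dA fa B(1)] by blast
    \<comment> \<open>Points entering a fixed box of \<open>A \<times> F\<close> at time
      \<open>n\<close>; \<open>\<Omega>\<close> consists of those that never enter it. Both depend
      only on the image in \<open>A \<times> F\<close>, hence on the first coordinate only through
      \<open>p\<close>.\<close>
    define O' where "O' n = {w \<in> X \<times> Z. zpow A RA n (a (fst w)) \<in> V \<and> zpow F Q n (q (snd w)) \<in> ball f r}" for n
    define \<Omega> where "\<Omega> = (X \<times> Z) - (\<Union>n. O' n)"
    have O'open: "openin (top_of_set (X \<times> Z)) (O' n)" for n
    proof -
      have aA: "a x \<in> A" if "x \<in> X" for x using that a(2) by auto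
      have qF: "q z \<in> F" if "z \<in> Z" for z using that q(2) by auto
      have "continuous_on (X \<times> Z) (\<lambda>w. zpow A RA n (a (fst w)))"
        by (rule continuous_on_compose2[OF continuous_on_zpow[OF dA] continuous_on_compose2[OF a(1)]])
          (auto intro: continuous_intros aA)
      moreover have "continuous_on (X \<times> Z) (\<lambda>w. zpow F Q n (q (snd w)))"
        by (rule continuous_on_compose2[OF continuous_on_zpow[OF dF] continuous_on_compose2[OF q(1)]])
          (auto intro: continuous_intros qF)
      ultimately have "continuous_on (X \<times> Z) (\<lambda>w. (zpow A RA n (a (fst w)), zpow F Q n (q (snd w))))"
        by (rule continuous_on_Pair)
      then have "openin (top_of_set (X \<times> Z)) (X \<times> Z \<inter>
          (\<lambda>w. (zpow A RA n (a (fst w)), zpow F Q n (q (snd w)))) -` (V \<times> ball f r))"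
        by (rule continuous_openin_preimage_gen) (intro open_Times V(1) open_ball)
      moreover have "X \<times> Z \<inter>
          (\<lambda>w. (zpow A RA n (a (fst w)), zpow F Q n (q (snd w)))) -` (V \<times> ball f r) = O' n"
        by (auto simp: O'_def)
      ultimately show ?thesis by simp
    qed
    have \<Omega>c: "closed \<Omega>"
    proof -
      have "closedin (top_of_set (X \<times> Z)) \<Omega>"
        unfolding \<Omega>_def using O'open by (intro closedin_diff openin_Union) auto
      then show ?thesis
        using closedin_compact[OF compact_Times[OF X'(1) Z'(1)]] compact_imp_closed by metis
    qed
    have \<Omega>inv: "(T x, S z) \<in> \<Omega> \<longleftrightarrow> (x, z) \<in> \<Omega>" if xz: "x \<in> X" "z \<in> Z" for x z
    proof -
      have "a x \<in> A" "q z \<in> F" using that a(2) q(2) by auto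
      then have "(T x, S z) \<in> O' n \<longleftrightarrow> (x, z) \<in> O' (n + 1)" for n
        using xz TX SZ a(3) q(3) zpow_Suc_right[OF dA] zpow_Suc_right[OF dF] by (simp add: O'_def)
      then have "(\<exists>n. (T x, S z) \<in> O' n) \<longleftrightarrow> (\<exists>n. (x, z) \<in> O' n)" by (metis diff_add_cancel)
      then show ?thesis using xz TX SZ by (auto simp: \<Omega>_def)
    qed
    \<comment> \<open>\<open>J2\<close> equals \<open>J\<close> over the tube and contains everything away from its image in \<open>A \<times> F\<close>, so that
      its image in \<open>Y \<times> Z\<close> is a joining covering \<open>A \<times> F\<close>.\<close>
    define J2 where "J2 = (J \<inter> C) \<union> \<Omega>"
    have J2: "closed J2" "J2 \<subseteq> X \<times> Z"
      using Jc Cc \<Omega>c JXZ by (auto simp: J2_def \<Omega>_def)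
    have "(T x, S z) \<in> J2 \<longleftrightarrow> (x, z) \<in> J2" if "x \<in> X" "z \<in> Z" for x z
      using Jinv[OF that] Cinv[OF that] \<Omega>inv[OF that] by (simp add: J2_def)
    then have J2T: "map_prod T S ` J2 = J2"
      unfolding image_eq_iff_invariant[OF bij J2(2)] by auto
    have J2onto: "\<exists>w\<in>J2. a (fst w) = u \<and> q (snd w) = v" if uv: "u \<in> A" "v \<in> F" for u v
    proof -
      obtain x z where xz: "x \<in> X" "z \<in> Z" "a x = u" "q z = v" using uv a(2) q(2) by blast
      show ?thesis
      proof (cases "(x, z) \<in> \<Omega>")
        case True
        then show ?thesis using xz by (intro bexI[of _ "(x, z)"]) (auto simp: J2_def)
      next
        case False
        \<comment> \<open>Outside \<open>\<Omega>\<close> the pair \<open>(u, v)\<close> enters the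
          box at time \<open>n\<close>, where its first coordinate has a lift over the ball about
          \<open>e\<close>. Moving this lift back by \<open>- n\<close> gives a lift of
          \<open>u\<close> over the tube.\<close>
        then obtain n where n: "zpow A RA n u \<in> V" "zpow F Q n v \<in> ball f r"
          using xz by (auto simp: \<Omega>_def O'_def)
        then have "zpow A RA n u \<in> a ` (B \<inter> X)" using V(3) zpow_closed[OF dA uv(1)] by blast
        then obtain x1 where x1: "x1 \<in> X" "\<pi> x1 \<in> ball e r" "zpow A RA n u = a x1"
          using B(2) by blast
        define z1 where "z1 = zpow Z S n z"
        have z1: "z1 \<in> Z" "q z1 = zpow F Q n v"
          using zpow_closed[OF dZ xz(2)] factor_map_zpow[OF dZ dF fF xz(2)] xz(4) by (auto simp: z1_def)
        have "(x1, z1) \<in> C" using x1 z1 n(2) by (intro Cball) auto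
        define x2 where "x2 = zpow X T (- n) x1"
        have x2: "x2 \<in> X" "(x2, z) \<in> C"
        proof -
          show "x2 \<in> X" using zpow_closed[OF dX x1(1)] by (simp add: x2_def)
          have "(zpow X T (- n) x1, zpow Z S (- n) z1) \<in> C"
            using \<open>(x1, z1) \<in> C\<close> zpow_pair_invariant[OF dX dZ Cinv x1(1) z1(1)] by blast
          then show "(x2, z) \<in> C"
            using zpow_uminus_cancel[OF dZ xz(2)] by (simp add: x2_def z1_def)
        qed
        have ax2: "a x2 = u"
          using factor_map_zpow[OF dX dA fa x1(1)] zpow_uminus_cancel[OF dA uv(1), of n] x1(3)
          by (simp add: x2_def)
        \<comment> \<open>Since \<open>J\<close> covers \<open>E \<times> F\<close>, it has a point
          with the same images as \<open>(x2, z)\<close>. That point stays in \<open>C\<close> and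
          over \<open>u\<close>, as both conditions depend on the images only.\<close>
        have "(\<pi> x2, q z) \<in> map_prod \<pi> q ` J" using onto x2(1) xz(2) \<pi>(2) q(2) by auto
        then obtain x3 z3 where x3: "(x3, z3) \<in> J" "\<pi> x3 = \<pi> x2" "q z3 = q z" by auto
        then have x3': "x3 \<in> X" "z3 \<in> Z" using JXZ by auto
        have "(x3, z3) \<in> C" using x2(2) x3 x3' by (simp add: C_def)
        moreover have "a x3 = u" using ax2 h x3(2) x3'(1) x2(1) by simp
        ultimately show ?thesis
          using x3 xz(4) by (intro bexI[of _ "(x3, z3)"]) (auto simp: J2_def)
      qed
    qed
    have "A \<noteq> {}" "F \<noteq> {}" using V(2) ef(2) by auto
    then have J2ne: "J2 \<noteq> {}" using J2onto by blast
    have jY: "joining Y R Z S (map_prod p id ` J2)"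
      by (rule joining_image_factor[OF X Z p J2 J2T J2ne])
    have "map_prod b q ` map_prod p id ` J2 = A \<times> F"
    proof
      show "map_prod b q ` map_prod p id ` J2 \<subseteq> A \<times> F"
        using J2(2) a(2) q(2) by (auto simp: a_def)
      show "A \<times> F \<subseteq> map_prod b q ` map_prod p id ` J2"
      proof
        fix w assume "w \<in> A \<times> F"
        then obtain w' where w': "w' \<in> J2" "a (fst w') = fst w" "q (snd w') = snd w"
          using J2onto[of "fst w" "snd w"] by auto
        then have "w = map_prod b q (map_prod p id w')"
          by (simp add: a_def prod_eq_iff)
        then show "w \<in> map_prod b q ` map_prod p id ` J2" using w'(1) by blast
      qed
    qed
    with jY have "joining Y R Z S (map_prod p id ` J2) \<and>
        map_prod b q ` map_prod p id ` J2 = A \<times> F" ..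
    with assms(6) conjI[OF mY mZ] have full: "map_prod p id ` J2 = Y \<times> Z"
      unfolding quasi_disjoint_def by (elim allE impE) assumption+
    define H where "H = J \<inter> C"
    have H: "closed H" "H \<subseteq> X \<times> Z" using Jc Cc JXZ by (auto simp: H_def)
    have "(T x, S z) \<in> H \<longleftrightarrow> (x, z) \<in> H" if "x \<in> X" "z \<in> Z" for x z
      using Jinv[OF that] Cinv[OF that] by (simp add: H_def)
    then have HT: "map_prod T S ` H = H"
      unfolding image_eq_iff_invariant[OF bij H(2)] by auto
    obtain U where U: "open U" "O' 0 = (X \<times> Z) \<inter> U" using O'open[of 0] by (auto simp: openin_open)
    obtain xv where xv: "xv \<in> X" "a xv \<in> V" using V(2) a(2) by blast
    obtain zv where zv: "zv \<in> Z" "q zv = f" using ef(2) q(2) by blast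
    have "(xv, zv) \<in> O' 0" using xv zv ef(3) by (simp add: O'_def)
    then have Une: "U \<inter> (X \<times> Z) \<noteq> {}" using U(2) by blast
    \<comment> \<open>Over \<open>O' 0\<close> the set \<open>\<Omega>\<close> is absent, a
      condition depending on \<open>x\<close> only through \<open>p x\<close>. So a point of
      \<open>J2\<close> above \<open>(p x, z)\<close> lies in \<open>H\<close>, and its first
      coordinate is a translate of \<open>x\<close> because the fibres of \<open>p\<close> are
      orbits.\<close>
    have UH: "\<exists>g\<in>carrier G. (act g x, z) \<in> H" if xz: "(x, z) \<in> U" "x \<in> X" "z \<in> Z" for x z
    proof -
      have "p x \<in> Y" using p xz(2) by (auto simp: factor_map_def)
      then have "(p x, z) \<in> map_prod p id ` J2" using full xz(3) by blast
      then obtain x3 where x3: "(x3, z) \<in> J2" "p x3 = p x" by auto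
      have "x3 \<in> X" using x3(1) J2(2) by auto
      then obtain g where g: "g \<in> carrier G" "x3 = act g x" using fib[OF xz(2)] x3(2) by blast
      have "(x, z) \<in> O' 0" using U(2) xz by blast
      then have "(x3, z) \<in> O' 0" using x3(2) \<open>x3 \<in> X\<close> by (simp add: O'_def a_def)
      then have "(x3, z) \<in> H" using x3(1) by (auto simp: J2_def H_def \<Omega>_def)
      then show ?thesis using g by blast
    qed
    obtain x z g where xzg: "x \<in> X" "z \<in> Z" "g \<in> carrier G"
      and fibH: "\<And>x' z'. x' \<in> X \<Longrightarrow> z' \<in> Z \<Longrightarrow> \<pi> x' = \<pi> x \<Longrightarrow> q z' = q z \<Longrightarrow> (act g x', z') \<in> H"
      by (rule fibre_in_translate[OF X Z mX mZ G act comm H HT U(1) Une UH]) (assumption+, rule that)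
    \<comment> \<open>The fibre of \<open>(act g x, z)\<close> lies over the tube and so contains a
      point off \<open>J\<close>. Moved back by the inverse of \<open>g\<close>, this point falls
      into the fibre of \<open>(x, z)\<close>, so by \<open>fibH\<close> it lies in \<open>H\<close>
      after all.\<close>
    have "(act g x, z) \<in> C" using fibH[of x z] xzg by (simp add: H_def)
    then obtain x2 z2 where x2: "x2 \<in> X" "z2 \<in> Z" "\<pi> x2 = \<pi> (act g x)" "q z2 = q z" "(x2, z2) \<notin> J"
      using avoid[of "\<pi> (act g x)" "q z"] by (auto simp: C_def)
    have i: "inv\<^bsub>G\<^esub> g \<in> carrier G" using G xzg(3) by (simp add: compact_group_def group.inv_closed)
    have gx: "act g x \<in> X" by (rule action_closed[OF G act xzg(3,1)])
    have "\<pi> (act (inv\<^bsub>G\<^esub> g) x2) = \<pi> (act (inv\<^bsub>G\<^esub> g) (act g x))"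
      by (rule action_respects_factor[OF G act comm mX i x2(1) gx x2(3)])
    then have "\<pi> (act (inv\<^bsub>G\<^esub> g) x2) = \<pi> x"
      by (simp add: action_inv_cancel(2)[OF G act xzg(3,1)])
    then have "(act g (act (inv\<^bsub>G\<^esub> g) x2), z2) \<in> H"
      by (intro fibH action_closed[OF G act i x2(1)] x2(2,4))
    then show False
      using x2(5) action_inv_cancel(1)[OF G act xzg(3) x2(1)] by (simp add: H_def)
  qed
qed

end
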